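(* Let $\Gamma$ be a convex digital polygon and let $E$ be a supporting edge of $\Gamma$ whose slope $a/b$ has complexity $n\ge 2$. Then the maximal segment containing $E$ includes at most $n$ other digital edges of $\Gamma$ on each side of $E$.
   Context: A standard line with slope $a/b$ and shift $\mu$ ($a,b,\mu\in\mathbb{Z}$, $\gcd(a,b)=1$) is the set of $(x,y)\in\mathbb{Z}^2$ with $\mu\le ax-by<\mu+|a|+|b|$; points with $ax-by=\mu$ are upper leaning points, those with $ax-by=\mu+|a|+|b|-1$ lower leaning points. A convex digital polygon (CDP) is a finite $\Gamma\subset\mathbb{Z}^2$ with $\Gamma=\mathrm{Conv}(\Gamma)\cap\mathbb{Z}^2$; its vertices (cyclically ordered) form the minimal subset whose convex hull digitizes to $\Gamma$. Its boundary points form a closed 4-connected digital curve (the contour) through the vertices in order; a digital edge is the portion of the contour between two consecutive vertices. A set of consecutive contour points is a digital straight segment (DSS) if it lies in some standard line; its leaning points are its points that are leaning points of its characteristic line (the standard line containing it with minimal $|a|+|b|$); leftmost/rightmost refer to contour order. A maximal segment is a DSS that cannot be extended by one contour point at either end and remain a DSS. A supporting edge is a digital edge whose two vertices are the leftmost and rightmost upper leaning points of some maximal segment. Reasoning is in the first octant (slopes $a/b$ with $0\le a\le b$), contour oriented so that the polygon lies on the side of the lower leaning points; other octants by symmetry. The complexity of a slope $a/b$ is the depth $n$ of its simple continued fraction expansion $a/b=[0,u_1,\dots,u_n]$. *)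

theory Defs
  imports "HOL-Analysis.Analysis"
begin

type_synonym pt = "int \<times> int"

definition toR :: "pt \<Rightarrow> real \<times> real" where
  "toR p = (real_of_int (fst p), real_of_int (snd p))"

definition digitize :: "(real \<times> real) set \<Rightarrow> pt set" where
  "digitize S = {p. toR p \<in> S}"

definition is_cdp :: "pt set \<Rightarrow> bool" where
  "is_cdp G \<longleftrightarrow> finite G \<and> G = digitize (convex hull (toR ` G))"

definition is_vertex_set :: "pt set \<Rightarrow> pt set \<Rightarrow> bool" where
  "is_vertex_set G V \<longleftrightarrow> V \<subseteq> G \<and> digitize (convex hull (toR ` V)) = G \<and>
     (\<forall>W. W \<subset> V \<longrightarrow> digitize (convex hull (toR ` W)) \<noteq> G)"

definition adj4 :: "pt \<Rightarrow> pt \<Rightarrow> bool" where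
  "adj4 p q \<longleftrightarrow> \<bar>fst p - fst q\<bar> + \<bar>snd p - snd q\<bar> = 1"

definition adj8 :: "pt \<Rightarrow> pt \<Rightarrow> bool" where
  "adj8 p q \<longleftrightarrow> max \<bar>fst p - fst q\<bar> \<bar>snd p - snd q\<bar> = 1"

definition boundary_pts :: "pt set \<Rightarrow> pt set" where
  "boundary_pts G = {p \<in> G. \<exists>q. adj8 p q \<and> q \<notin> G}"

definition cross :: "pt \<Rightarrow> pt \<Rightarrow> int" where
  "cross u w = fst u * snd w - snd u * fst w"

definition vsub :: "pt \<Rightarrow> pt \<Rightarrow> pt" where
  "vsub u w = (fst u - fst w, snd u - snd w)"

text \<open>A closed 4-connected digital curve, given as an L-periodic sequence c :: int => pt,
  whose points are exactly the boundary points of G, and which passes through the vertices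
  in (clockwise) order: for any two consecutive vertex occurrences, the whole polygon lies
  weakly on the right of the directed line joining them (so the polygon lies on the right
  of the contour).\<close>
definition contour_curve :: "pt set \<Rightarrow> pt set \<Rightarrow> (int \<Rightarrow> pt) \<Rightarrow> int \<Rightarrow> bool" where
  "contour_curve G V c L \<longleftrightarrow> L > 0 \<and> (\<forall>k. c (k + L) = c k) \<and>
     (\<forall>k. adj4 (c k) (c (k + 1))) \<and>
     c ` {0..<L} = boundary_pts G \<and>
     (\<forall>k k'. k < k' \<and> k' \<le> k + L \<and> c k \<in> V \<and> c k' \<in> V \<and>
        (\<forall>m. k < m \<and> m < k' \<longrightarrow> c m \<notin> V) \<and> c k \<noteq> c k' \<longrightarrow>
        (\<forall>z\<in>G. cross (vsub (c k') (c k)) (vsub z (c k)) \<le> 0))"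

definition is_contour :: "pt set \<Rightarrow> pt set \<Rightarrow> (int \<Rightarrow> pt) \<Rightarrow> int \<Rightarrow> bool" where
  "is_contour G V c L \<longleftrightarrow> contour_curve G V c L \<and>
     (\<forall>c' L'. contour_curve G V c' L' \<longrightarrow> L \<le> L')"

definition digital_edge :: "pt set \<Rightarrow> (int \<Rightarrow> pt) \<Rightarrow> int \<Rightarrow> int \<Rightarrow> int \<Rightarrow> bool" where
  "digital_edge V c L p q \<longleftrightarrow> p < q \<and> q - p \<le> L \<and> c p \<in> V \<and> c q \<in> V \<and>
     (\<forall>m. p < m \<and> m < q \<longrightarrow> c m \<notin> V)"

definition in_std_line :: "int \<Rightarrow> int \<Rightarrow> int \<Rightarrow> pt \<Rightarrow> bool" where
  "in_std_line a b \<mu> p \<longleftrightarrow>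
     \<mu> \<le> a * fst p - b * snd p \<and> a * fst p - b * snd p < \<mu> + \<bar>a\<bar> + \<bar>b\<bar>"

definition seg_in_line :: "(int \<Rightarrow> pt) \<Rightarrow> int \<Rightarrow> int \<Rightarrow> int \<Rightarrow> int \<Rightarrow> int \<Rightarrow> bool" where
  "seg_in_line c i j a b \<mu> \<longleftrightarrow> gcd a b = 1 \<and> (\<forall>k\<in>{i..j}. in_std_line a b \<mu> (c k))"

definition is_dss :: "(int \<Rightarrow> pt) \<Rightarrow> int \<Rightarrow> int \<Rightarrow> int \<Rightarrow> bool" where
  "is_dss c L i j \<longleftrightarrow> i \<le> j \<and> j - i < L \<and> (\<exists>a b \<mu>. seg_in_line c i j a b \<mu>)"

definition maximal_segment :: "(int \<Rightarrow> pt) \<Rightarrow> int \<Rightarrow> int \<Rightarrow> int \<Rightarrow> bool" where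
  "maximal_segment c L i j \<longleftrightarrow> is_dss c L i j \<and> \<not> is_dss c L (i - 1) j \<and> \<not> is_dss c L i (j + 1)"

text \<open>Characteristic line: a containing standard line with minimal |a|+|b|, with the sign
  of (a,b) chosen so that the segment runs in direction (b,a) (then lower leaning points lie
  on the polygon side, the contour being oriented with the polygon on its right).\<close>
definition char_line :: "(int \<Rightarrow> pt) \<Rightarrow> int \<Rightarrow> int \<Rightarrow> int \<Rightarrow> int \<Rightarrow> int \<Rightarrow> bool" where
  "char_line c i j a b \<mu> \<longleftrightarrow> seg_in_line c i j a b \<mu> \<and>
     (\<forall>a' b' \<mu>'. seg_in_line c i j a' b' \<mu>' \<longrightarrow> \<bar>a\<bar> + \<bar>b\<bar> \<le> \<bar>a'\<bar> + \<bar>b'\<bar>) \<and>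
     b * (fst (c j) - fst (c i)) + a * (snd (c j) - snd (c i)) > 0"

definition upper_leaning :: "int \<Rightarrow> int \<Rightarrow> int \<Rightarrow> pt \<Rightarrow> bool" where
  "upper_leaning a b \<mu> p \<longleftrightarrow> a * fst p - b * snd p = \<mu>"

definition leftmost_upper :: "(int \<Rightarrow> pt) \<Rightarrow> int \<Rightarrow> int \<Rightarrow> int \<Rightarrow> int \<Rightarrow> int \<Rightarrow> int \<Rightarrow> bool" where
  "leftmost_upper c i j a b \<mu> p \<longleftrightarrow> i \<le> p \<and> p \<le> j \<and> upper_leaning a b \<mu> (c p) \<and>
     (\<forall>k. i \<le> k \<and> k < p \<longrightarrow> \<not> upper_leaning a b \<mu> (c k))"

definition rightmost_upper :: "(int \<Rightarrow> pt) \<Rightarrow> int \<Rightarrow> int \<Rightarrow> int \<Rightarrow> int \<Rightarrow> int \<Rightarrow> int \<Rightarrow> bool" where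
  "rightmost_upper c i j a b \<mu> q \<longleftrightarrow> i \<le> q \<and> q \<le> j \<and> upper_leaning a b \<mu> (c q) \<and>
     (\<forall>k. q < k \<and> k \<le> j \<longrightarrow> \<not> upper_leaning a b \<mu> (c k))"

text \<open>Depth of the continued fraction expansion of a/b (0 <= a <= b) via the Euclidean
  algorithm: a/b = [0; b div a, ...], last partial quotient >= 2 (except for 1 = [0;1]).\<close>
function cf_depth :: "nat \<Rightarrow> nat \<Rightarrow> nat" where
  "cf_depth a b = (if a = 0 then 0 else Suc (cf_depth (b mod a) a))"
  by auto
termination by (relation "Wellfounded.measure fst") auto

text \<open>Complexity of the slope a/b, after reduction to the first octant by symmetry.\<close>
definition slope_complexity :: "int \<Rightarrow> int \<Rightarrow> nat" where
  "slope_complexity a b = cf_depth (nat (min \<bar>a\<bar> \<bar>b\<bar>)) (nat (max \<bar>a\<bar> \<bar>b\<bar>))"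

end

theory Submission
  imports Defs
begin

text \<open>
  Rotate the lattice so that the characteristic line has coefficients \<open>a, b > 0\<close>, and look at the part of the
  maximal segment before its first upper leaning point \<open>U\<close>; the part after the last one is the same
  situation after a reflection and a reversal of time. The vertices visited before \<open>U\<close> form a convex
  chain, and since the walk runs through all points of the strip, the edges of this chain support all
  lattice points on the polygon side of the upper leaning line in a window ending at \<open>U\<close>. Such edges are
  counted by the Euclidean algorithm: with \<open>b = u a + c\<close>, at most one non-vertical edge is steeper
  than \<open>1/u\<close>, and a shear reduces the others to the slope \<open>c/a\<close>.

  The contour is only known to be a shortest closed walk, so it may turn back. Turning back at a
  non-vertex that is also visited at another time contradicts minimality; the one remaining possibility is a
  detour at the first vertex of the chain, and in that case the chain itself has one edge less.
\<close>

section \<open>Supporting edges and continued fractions\<close>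

text \<open>Taken alone, the recursion allows one edge too many: for \<open>a < b\<close>, a
  vertical edge, a steep nonvertical edge and the flatter ones. The width \<open>a + b\<close> of
  the strip saves the bound. Both extra edges end at the far border of the window, the vertical one
  above the steep one, and together they would reach a remainder of at least \<open>a + b\<close>.
  For \<open>b < a\<close> the first partial quotient pays for the vertical edge. A detour adds a
  visit to a vertex without adding an edge, and in turn excludes an extra edge. In the rotated
  coordinates it enters the point below its vertex. For \<open>a < b\<close> this keeps all
  remainders of the chain below \<open>a\<close>, so neither extra edge occurs; for
  \<open>b < a\<close> a vertical edge would make its lower end a non-extreme point. Both orders of
  \<open>a\<close> and \<open>b\<close> have to be treated: the window is bounded by vertical lines,
  and the lattice symmetry is already fixed by the signs of the coefficients and the direction of
  time.\<close>

declare cf_depth.simps [simp del]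

lemma cf_depth_rec:
  assumes "0 < a" "0 \<le> b"
  shows "cf_depth (nat a) (nat b) = Suc (cf_depth (nat (b mod a)) (nat a))"
  using assms by (subst cf_depth.simps) (simp add: nat_mod_distrib)

text \<open>A quadruple \<open>(px, py, ex, ey)\<close> stands for the edge from \<open>(px, py)\<close> to \<open>(px + ex, py + ey)\<close>.
  All edges are supporting for the lattice points on or above the line \<open>a x = b y\<close> with
  \<open>0 \<le> x \<le> N\<close>, are steeper than this line, and have pairwise different slopes.\<close>

definition supporting_edges :: "int \<Rightarrow> int \<Rightarrow> int \<Rightarrow> (int \<times> int \<times> int \<times> int) set \<Rightarrow> bool" where
  "supporting_edges a b N E \<longleftrightarrow> finite E \<and>
     (\<forall>(px, py, ex, ey) \<in> E. 0 \<le> px \<and> 0 \<le> ex \<and> px + ex \<le> N \<and> a * px \<le> b * py \<and> a * ex < b * ey \<and>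
        (\<forall>x y. 0 \<le> x \<and> x \<le> N \<and> a * x \<le> b * y \<longrightarrow> 0 \<le> ex * (y - py) - ey * (x - px))) \<and>
     (\<forall>(px, py, ex, ey) \<in> E. \<forall>(px', py', ex', ey') \<in> E.
        ex * ey' = ey * ex' \<longrightarrow> (px, py, ex, ey) = (px', py', ex', ey'))"

lemma supporting_edgesD:
  assumes "supporting_edges a b N E" "(px, py, ex, ey) \<in> E"
  shows "0 \<le> px" "0 \<le> ex" "px + ex \<le> N" "a * px \<le> b * py" "a * ex < b * ey"
    "\<And>x y. 0 \<le> x \<Longrightarrow> x \<le> N \<Longrightarrow> a * x \<le> b * y \<Longrightarrow> 0 \<le> ex * (y - py) - ey * (x - px)"
    "\<And>px' py' ex' ey'. (px', py', ex', ey') \<in> E \<Longrightarrow> ex * ey' = ey * ex' \<Longrightarrow>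
       px' = px \<and> py' = py \<and> ex' = ex \<and> ey' = ey"
proof -
  have *: "0 \<le> px \<and> 0 \<le> ex \<and> px + ex \<le> N \<and> a * px \<le> b * py \<and> a * ex < b * ey \<and>
        (\<forall>x y. 0 \<le> x \<and> x \<le> N \<and> a * x \<le> b * y \<longrightarrow> 0 \<le> ex * (y - py) - ey * (x - px))"
    using bspec[OF conjunct1[OF conjunct2[OF assms(1)[unfolded supporting_edges_def]]] assms(2)]
    unfolding prod.case .
  then show "0 \<le> px" "0 \<le> ex" "px + ex \<le> N" "a * px \<le> b * py" "a * ex < b * ey"
    "\<And>x y. 0 \<le> x \<Longrightarrow> x \<le> N \<Longrightarrow> a * x \<le> b * y \<Longrightarrow> 0 \<le> ex * (y - py) - ey * (x - px)"
    by blast+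
  have "\<forall>(px', py', ex', ey') \<in> E. ex * ey' = ey * ex' \<longrightarrow> (px, py, ex, ey) = (px', py', ex', ey')"
    using bspec[OF conjunct2[OF conjunct2[OF assms(1)[unfolded supporting_edges_def]]] assms(2)]
    unfolding prod.case .
  then show "px' = px \<and> py' = py \<and> ex' = ex \<and> ey' = ey"
    if "(px', py', ex', ey') \<in> E" "ex * ey' = ey * ex'" for px' py' ex' ey'
    using that by fast
qed

lemma supporting_edges_finite: "supporting_edges a b N E \<Longrightarrow> finite E"
  by (simp add: supporting_edges_def)

lemma subset_ball: "\<forall>x\<in>A. P x \<Longrightarrow> B \<subseteq> A \<Longrightarrow> \<forall>x\<in>B. P x"
  by blast

lemma supporting_edges_subset:
  "supporting_edges a b N E \<Longrightarrow> F \<subseteq> E \<Longrightarrow> supporting_edges a b N F"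
  unfolding supporting_edges_def
proof (elim conjE, intro conjI)
  assume F: "F \<subseteq> E"
  show "finite E \<Longrightarrow> finite F" using F by (rule finite_subset)
next
  assume F: "F \<subseteq> E"
  assume "\<forall>(px, py, ex, ey)\<in>E. \<forall>(px', py', ex', ey')\<in>E. ex * ey' = ey * ex' \<longrightarrow>
        (px, py, ex, ey) = (px', py', ex', ey')"
  from subset_ball[OF this F]
  show "\<forall>(px, py, ex, ey)\<in>F. \<forall>(px', py', ex', ey')\<in>F. ex * ey' = ey * ex' \<longrightarrow>
        (px, py, ex, ey) = (px', py', ex', ey')"
    using F by fast
qed (erule subset_ball)

section \<open>Vertical and steep edges\<close>

lemma card_vertical_le_1:
  assumes E: "supporting_edges a b N E" and vert: "\<And>px py ex ey. (px, py, ex, ey) \<in> E \<Longrightarrow> ex = 0"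
  shows "card E \<le> 1"
proof -
  have "s = t" if "s \<in> E" "t \<in> E" for s t
  proof -
    obtain px py ex ey where s: "s = (px, py, ex, ey)" by (rule prod_cases4)
    obtain px' py' ex' ey' where t: "t = (px', py', ex', ey')" by (rule prod_cases4)
    have "ex = 0" "ex' = 0" using vert that s t by blast+
    then show ?thesis
      using supporting_edgesD(7)[OF E, of px py ex ey px' py' ex' ey'] that s t by simp
  qed
  then show ?thesis
    unfolding One_nat_def card_le_Suc0_iff_eq[OF supporting_edges_finite[OF E]] by blast
qed

text \<open>If the window reached \<open>px + u\<close>, the point \<open>(px + u, py + 1)\<close>
  would lie above the line but on the wrong side of the edge. So the window ends earlier, and
  testing \<open>(N, py + 1)\<close> instead forces the edge to rise by one and to end at the
  border.\<close>

lemma steep_edge: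
  assumes E: "supporting_edges a b N E" and e: "(px, py, ex, ey) \<in> E"
    and a: "0 < a" and u: "u * a \<le> b" and b: "0 < b" and ex: "0 < ex" and steep: "ex < u * ey"
  shows "ey = 1" "px + ex = N" "a \<le> b * (py + ey) - a * (px + ex)"
proof -
  note D = supporting_edgesD[OF E e]
  define M where "M = N - px"
  have M: "1 \<le> M" "ex \<le> M" using D ex by (auto simp: M_def)
  have ey: "1 \<le> ey"
    using D(5) a b ex by (smt (verit) mult_nonneg_nonneg mult_nonneg_nonpos)
  have Mu: "M < u"
  proof (rule ccontr)
    assume "\<not> M < u"
    moreover have "0 \<le> u" using steep ex ey by (smt (verit) mult_nonpos_nonneg)
    moreover have "a * (px + u) \<le> b * (py + 1)" using D(4) u by (simp add: algebra_simps)
    ultimately have "0 \<le> ex * 1 - ey * u"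
      using D(6)[of "px + u" "py + 1"] D(1) by (simp add: M_def)
    then show False using steep by (simp add: algebra_simps)
  qed
  have "a * M \<le> a * (u - 1)" using Mu a by (intro mult_left_mono) auto
  then have aM: "a * M \<le> b - a" using u by (simp add: algebra_simps)
  have "a * (px + M) \<le> b * (py + 1)" using D(4) aM a by (simp add: algebra_simps)
  then have *: "ey * M \<le> ex"
    using D(6)[of "px + M" "py + 1"] D(1) M by (simp add: M_def)
  have "M \<le> ey * M" using ey M by simp
  then have eq: "ex = M" "ey * M = M" using * M by linarith+
  show ey1: "ey = 1" using eq(2) M by simp
  show "px + ex = N" using eq(1) by (simp add: M_def)
  show "a \<le> b * (py + ey) - a * (px + ex)"
    using eq(1) ey1 aM D(4) by (simp add: algebra_simps)
qed

text \<open>All steep edges rise by one and end at \<open>x = N\<close>; testing each of two against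
  the endpoints of the other makes them coincide.\<close>

lemma card_steep_le_1:
  assumes E: "supporting_edges a b N E" and a: "0 < a" and u: "u * a \<le> b" and b: "0 < b"
    and st: "\<And>px py ex ey. (px, py, ex, ey) \<in> E \<Longrightarrow> 0 < ex \<and> ex < u * ey"
  shows "card E \<le> 1"
proof -
  have le: "ex' \<le> ex" if "(px, py, ex, ey) \<in> E" "(px', py', ex', ey') \<in> E" for px py ex ey px' py' ex' ey'
  proof -
    note D = supporting_edgesD[OF E that(1)] and D' = supporting_edgesD[OF E that(2)]
    note S = steep_edge[OF E that(1) a u b conjunct1[OF st[OF that(1)]] conjunct2[OF st[OF that(1)]]]
    note S' = steep_edge[OF E that(2) a u b conjunct1[OF st[OF that(2)]] conjunct2[OF st[OF that(2)]]]
    have pos: "0 < ex" "0 < ex'" using st that by auto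
    have "0 \<le> ex * (py' + ey' - py) - ey * (px' + ex' - px)"
      using D(6)[of "px' + ex'" "py' + ey'"] D'(1,2,3,4,5) by (simp add: algebra_simps)
    then have "0 \<le> ex * (py' - py)" using S S' by (simp add: algebra_simps)
    then have 1: "py \<le> py'" using pos by (simp add: zero_le_mult_iff)
    have "0 \<le> ex' * (py + ey - py') - ey' * (px + ex - px')"
      using D'(6)[of "px + ex" "py + ey"] D(1,2,3,4,5) by (simp add: algebra_simps)
    then have "0 \<le> ex' * (py - py')" using S S' by (simp add: algebra_simps)
    then have 2: "py' \<le> py" using pos by (simp add: zero_le_mult_iff)
    have "0 \<le> ex * (py' - py) - ey * (px' - px)"
      using D(6)[of px' py'] D'(1,2,3,4) by simp
    then have "px' \<le> px" using 1 2 S by simp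
    moreover have "0 \<le> ex' * (py - py') - ey' * (px - px')"
      using D'(6)[of px py] D(1,2,3,4) by simp
    then have "px \<le> px'" using 1 2 S' by simp
    ultimately show ?thesis using S S' by simp
  qed
  have "s = t" if st': "s \<in> E" "t \<in> E" for s t
  proof -
    obtain px py ex ey where s: "s = (px, py, ex, ey)" by (rule prod_cases4)
    obtain px' py' ex' ey' where t: "t = (px', py', ex', ey')" by (rule prod_cases4)
    note st_eq = s t
    have "ex = ex'" using le st' st_eq by (metis order_antisym)
    moreover have "ey = 1" "ey' = 1"
      using steep_edge(1)[OF E _ a u b] st st' st_eq by blast+
    ultimately show ?thesis
      using supporting_edgesD(7)[OF E, of px py ex ey px' py' ex' ey'] st' st_eq by simp
  qed
  then show ?thesis
    unfolding One_nat_def card_le_Suc0_iff_eq[OF supporting_edges_finite[OF E]] by blast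
qed

text \<open>The sheared window is slanted, so a new upright one is cut out, reaching to the farthest
  end of a sheared edge. The delicate points are those of the new window whose preimages lie beyond
  \<open>N\<close>.\<close>

lemma shear_x:
  assumes E: "supporting_edges a b N E" and a: "0 < a" and u: "0 \<le> u" "u * a < b"
    and shallow: "\<And>px py ex ey. (px, py, ex, ey) \<in> E \<Longrightarrow> u * ey \<le> ex"
  obtains N' E' where "supporting_edges a (b - u * a) N' E'" "card E' = card E"
proof -
  have b: "0 < b" using a u by (smt (verit) mult_nonneg_nonneg)
  define sh where "sh = (\<lambda>(px, py, ex, ey). (px - u * py, py, ex - u * ey, ey :: int))"
  define en where "en = (\<lambda>(px, py, ex, ey). px + ex - u * (py + ey :: int))"
  define N' where "N' = (if E = {} then 0 else Max (en ` E))"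
  have fin: "finite E" using E by (rule supporting_edges_finite)
  have inj: "inj_on sh E" by (auto simp: inj_on_def sh_def)
  have enN: "en s \<le> N'" if "s \<in> E" for s
    using that fin by (auto simp: N'_def)
  have "supporting_edges a (b - u * a) N' (sh ` E)"
    unfolding supporting_edges_def
  proof (intro conjI ballI)
    show "finite (sh ` E)" using fin by simp
    show "case s of (px, py, ex, ey) \<Rightarrow> \<forall>(px', py', ex', ey')\<in>sh ` E. ex * ey' = ey * ex' \<longrightarrow>
        (px, py, ex, ey) = (px', py', ex', ey')" if "s \<in> sh ` E" for s
    proof -
      obtain px py ex ey where s: "(px, py, ex, ey) \<in> E" "s = sh (px, py, ex, ey)"
        using \<open>s \<in> sh ` E\<close> by auto
      have "sh (px, py, ex, ey) = sh (px', py', ex', ey')"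
        if "(px', py', ex', ey') \<in> E" "(ex - u * ey) * ey' = ey * (ex' - u * ey')" for px' py' ex' ey'
      proof -
        have "ex * ey' = ey * ex'" using that(2) by (simp add: algebra_simps)
        then show ?thesis using supporting_edgesD(7)[OF E s(1) that(1)] by simp
      qed
      then show ?thesis using s(2) by (auto simp: sh_def)
    qed
    show "case s of (px, py, ex, ey) \<Rightarrow> 0 \<le> px \<and> 0 \<le> ex \<and> px + ex \<le> N' \<and> a * px \<le> (b - u * a) * py \<and>
        a * ex < (b - u * a) * ey \<and>
        (\<forall>x y. 0 \<le> x \<and> x \<le> N' \<and> a * x \<le> (b - u * a) * y \<longrightarrow> 0 \<le> ex * (y - py) - ey * (x - px))"
      if "s \<in> sh ` E" for s
    proof -
      obtain px py ex ey where s: "(px, py, ex, ey) \<in> E" "s = sh (px, py, ex, ey)"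
        using \<open>s \<in> sh ` E\<close> by auto
      note D = supporting_edgesD[OF E s(1)]
      have py: "0 \<le> py" using D(1,4) a b
        by (smt (verit) mult_nonneg_nonneg mult_pos_neg)
      have ey: "0 < ey" using D(2,5) a b
        by (smt (verit) mult_nonneg_nonneg mult_nonneg_nonpos)
      \<comment> \<open>The origin is supported by the edge; with \<open>shallow\<close> this keeps
        the sheared starting point at nonnegative \<open>x\<close>.\<close>
      have "ex * py \<le> ey * px" using D(6)[of 0 0] D(1,2,3) by simp
      moreover have "u * ey * py \<le> ex * py" using shallow[OF s(1)] py by (rule mult_right_mono)
      ultimately have "ey * (u * py) \<le> ey * px" by (simp add: algebra_simps)
      then have 1: "0 \<le> px - u * py" using ey by simp
      have 2: "0 \<le> ex - u * ey" using shallow[OF s(1)] by simp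
      have 3: "px - u * py + (ex - u * ey) \<le> N'"
        using enN[OF s(1)] by (simp add: en_def algebra_simps)
      have 4: "a * (px - u * py) \<le> (b - u * a) * py" "a * (ex - u * ey) < (b - u * a) * ey"
        using D(4,5) by (simp_all add: algebra_simps)
      have 5: "0 \<le> (ex - u * ey) * (y - py) - ey * (x - (px - u * py))"
        if x: "0 \<le> x" "x \<le> N'" "a * x \<le> (b - u * a) * y" for x y
      proof -
        define X where "X = x + u * y"
        have y: "0 \<le> y" using x a u
          by (smt (verit) mult_nonneg_nonneg mult_pos_neg)
        have X0: "0 \<le> X" using x y u by (simp add: X_def)
        have aX: "a * X \<le> b * y" using x(3) by (simp add: X_def algebra_simps)
        have goal: "(ex - u * ey) * (y - py) - ey * (x - (px - u * py)) = ex * (y - py) - ey * (X - px)"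
          by (simp add: X_def algebra_simps)
        show ?thesis
        proof (cases "X \<le> N")
          case True
          then show ?thesis using D(6)[OF X0 _ aX] goal by simp
        next
          case False
          \<comment> \<open>The preimage is reached from the far end of the extremal edge, a point
            already tested, by a vector of slope at least \<open>1/u\<close>. No edge is steeper
            than \<open>1/u\<close>, so this vector does not leave its supported side.\<close>
          obtain qx qy gx gy where q: "(qx, qy, gx, gy) \<in> E" "N' = en (qx, qy, gx, gy)"
          proof -
            have "E \<noteq> {}" using s by auto
            then have "N' \<in> en ` E" using fin by (simp add: N'_def Max_in del: Max_in)
              (metis Max_in finite_imageI image_is_empty)
            then show ?thesis using that by auto
          qed
          note Q = supporting_edgesD[OF E q(1)]
          have *: "0 \<le> ex * (qy + gy - py) - ey * (qx + gx - px)"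
            using D(6)[of "qx + gx" "qy + gy"] Q(1-5) by (simp add: algebra_simps)
          define dX dY where "dX = X - (qx + gx)" and "dY = y - (qy + gy)"
          have dX: "0 < dX" using False Q(3) by (simp add: dX_def)
          have le: "dX \<le> u * dY" using x(2) q(2) by (simp add: dX_def dY_def en_def X_def algebra_simps)
          have dY: "0 \<le> dY" using dX le u by (smt (verit) mult_nonneg_nonpos)
          have "ey * dX \<le> ey * (u * dY)" using le ey by simp
          also have "\<dots> = (u * ey) * dY" by simp
          also have "\<dots> \<le> ex * dY" using shallow[OF s(1)] dY by (rule mult_right_mono)
          finally have "0 \<le> ex * dY - ey * dX" by simp
          with * show ?thesis unfolding goal by (simp add: dX_def dY_def algebra_simps)
        qed
      qed
      show ?thesis using 1 2 3 4 5 s(2) by (auto simp: sh_def)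
    qed
  qed
  then show ?thesis using that card_image[OF inj] by blast
qed

text \<open>Columns are preserved, hence the window is too. The last conclusion serves to transfer
  the absence of vertical edges.\<close>

lemma shear_y:
  assumes E: "supporting_edges a b N E"
  obtains E' where "supporting_edges (a - w * b) b N E'" "card E' = card E"
    "\<And>px py ex ey. (px, py, ex, ey) \<in> E' \<Longrightarrow> (px, py + w * px, ex, ey + w * ex) \<in> E"
proof -
  define sh where "sh = (\<lambda>(px, py, ex, ey). (px, py - w * px, ex, ey - w * ex :: int))"
  have inj: "inj_on sh E" by (auto simp: inj_on_def sh_def)
  have "supporting_edges (a - w * b) b N (sh ` E)"
    unfolding supporting_edges_def
  proof (intro conjI ballI)
    show "finite (sh ` E)" using supporting_edges_finite[OF E] by simp
    show "case s of (px, py, ex, ey) \<Rightarrow> \<forall>(px', py', ex', ey')\<in>sh ` E. ex * ey' = ey * ex' \<longrightarrow>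
        (px, py, ex, ey) = (px', py', ex', ey')" if "s \<in> sh ` E" for s
    proof -
      obtain px py ex ey where s: "(px, py, ex, ey) \<in> E" "s = sh (px, py, ex, ey)"
        using \<open>s \<in> sh ` E\<close> by auto
      have "sh (px, py, ex, ey) = sh (px', py', ex', ey')"
        if "(px', py', ex', ey') \<in> E" "ex * (ey' - w * ex') = (ey - w * ex) * ex'" for px' py' ex' ey'
      proof -
        have "ex * ey' = ey * ex'" using that(2) by (simp add: algebra_simps)
        then show ?thesis using supporting_edgesD(7)[OF E s(1) that(1)] by simp
      qed
      then show ?thesis using s(2) by (auto simp: sh_def)
    qed
    show "case s of (px, py, ex, ey) \<Rightarrow> 0 \<le> px \<and> 0 \<le> ex \<and> px + ex \<le> N \<and> (a - w * b) * px \<le> b * py \<and>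
        (a - w * b) * ex < b * ey \<and>
        (\<forall>x y. 0 \<le> x \<and> x \<le> N \<and> (a - w * b) * x \<le> b * y \<longrightarrow> 0 \<le> ex * (y - py) - ey * (x - px))"
      if "s \<in> sh ` E" for s
    proof -
      obtain px py ex ey where s: "(px, py, ex, ey) \<in> E" "s = sh (px, py, ex, ey)"
        using \<open>s \<in> sh ` E\<close> by auto
      note D = supporting_edgesD[OF E s(1)]
      have "0 \<le> ex * (y - (py - w * px)) - (ey - w * ex) * (x - px)"
        if x: "0 \<le> x" "x \<le> N" "(a - w * b) * x \<le> b * y" for x y
        using D(6)[of x "y + w * x"] x by (simp add: algebra_simps)
      then show ?thesis using D(1-5) s(2) by (auto simp: sh_def algebra_simps)
    qed
  qed
  moreover have "(px, py + w * px, ex, ey + w * ex) \<in> E" if "(px, py, ex, ey) \<in> sh ` E" for px py ex ey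
    using that by (auto simp: sh_def)
  ultimately show ?thesis using that card_image[OF inj] by blast
qed

section \<open>The recursion along the Euclidean algorithm\<close>

text \<open>With \<open>u = b div a\<close>, the edges of slope at most \<open>1/u\<close> survive the shear \<open>x - u y\<close>, which
  turns the slope \<open>a/b\<close> into \<open>a/(b mod a)\<close>; after that the shear in the other direction costs only the
  vertical edge. So two partial quotients account for two edges.\<close>

lemma card_shallow_le_cf_depth:
  assumes "supporting_edges a b N E" "0 < a" "0 \<le> b"
    and IH: "\<And>a' b' N E. 0 \<le> a' \<Longrightarrow> a' < a \<Longrightarrow> a' < b' \<Longrightarrow> supporting_edges a' b' N E \<Longrightarrow>
      (\<And>px py ex ey. (px, py, ex, ey) \<in> E \<Longrightarrow> 0 < ex) \<Longrightarrow> card E \<le> cf_depth (nat a') (nat b')"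
    and shallow: "\<And>px py ex ey. (px, py, ex, ey) \<in> E \<Longrightarrow> (b div a) * ey \<le> ex"
  shows "card E \<le> cf_depth (nat (b mod a)) (nat a)"
proof (cases "b mod a = 0")
  case True
  have "E = {}"
  proof (rule ccontr)
    assume "E \<noteq> {}"
    then obtain px py ex ey where e: "(px, py, ex, ey) \<in> E" by auto
    \<comment> \<open>Here \<open>1/u\<close> is the slope \<open>a/b\<close> itself, and an edge
      steeper than the line cannot be shallow.\<close>
    have "b = a * (b div a)" using True by auto
    then have "b * ey = a * (b div a * ey)" by (metis mult.assoc)
    also have "\<dots> \<le> a * ex" using shallow[OF e] assms(2) by simp
    finally show False using supporting_edgesD(5)[OF assms(1) e] by simp
  qed
  then show ?thesis by simp
next
  case False
  define u c where "u = b div a" and "c = b mod a"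
  have c: "0 < c" "c < a" "c = b - u * a"
    using False pos_mod_sign[OF assms(2), of b] pos_mod_bound[OF assms(2), of b]
    by (auto simp: c_def u_def minus_div_mult_eq_mod)
  have u: "0 \<le> u" "u * a < b" using c assms by (auto simp: u_def pos_imp_zdiv_nonneg_iff)
  obtain N1 E1 where E1: "supporting_edges a c N1 E1" "card E1 = card E"
    using shear_x[OF assms(1,2) u] shallow unfolding c(3) u_def by metis
  define w d where "w = a div c" and "d = a mod c"
  have d: "0 \<le> d" "d < c" "d = a - w * c"
    using c by (auto simp: d_def w_def minus_div_mult_eq_mod)
  \<comment> \<open>A vertical edge is now the image of an edge of slope exactly \<open>1/u\<close>;
    it is set aside because \<open>IH\<close> speaks of nonvertical edges.\<close>
  define Ev Es where "Ev = {s \<in> E1. fst (snd (snd s)) = 0}" and "Es = {s \<in> E1. fst (snd (snd s)) \<noteq> 0}"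
  have "card E1 = card Ev + card Es"
    using supporting_edges_finite[OF E1(1)] unfolding Ev_def Es_def
    by (subst card_Un_disjoint[symmetric]) (auto intro!: arg_cong[where f = card])
  moreover have "card Ev \<le> 1"
    by (rule card_vertical_le_1[of a c N1]) (auto intro: supporting_edges_subset[OF E1(1)] simp: Ev_def)
  moreover have "card Es \<le> cf_depth (nat d) (nat c)"
  proof -
    have Es: "supporting_edges a c N1 Es"
      by (rule supporting_edges_subset[OF E1(1)]) (auto simp: Es_def)
    obtain E2 where E2: "supporting_edges d c N1 E2" "card E2 = card Es"
      "\<And>px py ex ey. (px, py, ex, ey) \<in> E2 \<Longrightarrow> (px, py + w * px, ex, ey + w * ex) \<in> Es"
      using shear_y[OF Es, of w] unfolding d(3) by metis
    have "0 < ex" if "(px, py, ex, ey) \<in> E2" for px py ex ey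
      using E2(3)[OF that] supporting_edgesD(2)[OF E2(1) that] by (auto simp: Es_def)
    then have "card E2 \<le> cf_depth (nat d) (nat c)"
      using IH[of d c N1 E2] d c E2(1) by auto
    then show ?thesis using E2(2) by simp
  qed
  moreover have "cf_depth (nat c) (nat a) = Suc (cf_depth (nat d) (nat c))"
    using cf_depth_rec[of c a] c assms(2) by (simp add: d_def)
  ultimately show ?thesis using E1(2) by (simp add: c_def)
qed

text \<open>Vertical edges stay out of the induction because a vertical and a steep edge can occur
  together: the width of the strip is not recorded in \<open>supporting_edges\<close>.\<close>

lemma card_nonvertical_le_cf_depth:
  assumes "0 \<le> a" "a < b" "supporting_edges a b N E"
    and "\<And>px py ex ey. (px, py, ex, ey) \<in> E \<Longrightarrow> 0 < ex"
  shows "card E \<le> cf_depth (nat a) (nat b)"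
  using assms
proof (induction "nat a" arbitrary: a b N E rule: less_induct)
  case less
  show ?case
  proof (cases "a = 0")
    case True
    have "E = {}"
    proof (rule ccontr)
      assume "E \<noteq> {}"
      then obtain px py ex ey where e: "(px, py, ex, ey) \<in> E" by auto
      note D = supporting_edgesD[OF less(4) e]
      have ex: "0 < ex" using less(5) e by blast
      have b: "0 < b" using True less by simp
      have ey: "0 < ey" "0 \<le> py" using D(4,5) True b by (auto simp: zero_less_mult_iff zero_le_mult_iff)
      \<comment> \<open>On the line \<open>y = 0\<close> the point \<open>(N, 0)\<close> lies
        strictly to the right of a rising nonvertical edge.\<close>
      have "0 \<le> ex * (0 - py) - ey * (N - px)" using D(6)[of N 0] D(1,3) ex True by simp
      moreover have "0 < ey * (N - px)" using ey D(3) ex by simp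
      moreover have "0 \<le> ex * py" using ex ey by simp
      ultimately show False by simp
    qed
    then show ?thesis by simp
  next
    case False
    then have a: "0 < a" using less by simp
    define u where "u = b div a"
    have u: "u * a \<le> b" using a unfolding u_def by (metis div_mult_mod_eq le_add_same_cancel1 pos_mod_sign)
    define Es Ef where "Es = {s \<in> E. fst (snd (snd s)) < u * snd (snd (snd s))}"
      and "Ef = {s \<in> E. u * snd (snd (snd s)) \<le> fst (snd (snd s))}"
    have "card E = card Es + card Ef"
      using supporting_edges_finite[OF less(4)] unfolding Es_def Ef_def
      by (subst card_Un_disjoint[symmetric]) (auto intro!: arg_cong[where f = card])
    moreover have "card Es \<le> 1"
      by (rule card_steep_le_1[of a b N _ u])
        (use less a u in \<open>auto intro: supporting_edges_subset[OF less(4)] simp: Es_def\<close>)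
    moreover have "card Ef \<le> cf_depth (nat (b mod a)) (nat a)"
    proof (rule card_shallow_le_cf_depth)
      show "supporting_edges a b N Ef" by (rule supporting_edges_subset[OF less(4)]) (auto simp: Ef_def)
      show "card E \<le> cf_depth (nat a') (nat b')"
        if "0 \<le> a'" "a' < a" "a' < b'" "supporting_edges a' b' N E"
          "\<And>px py ex ey. (px, py, ex, ey) \<in> E \<Longrightarrow> 0 < ex" for a' b' N E
        by (rule less(1)) (use that in auto)
    qed (use a less in \<open>auto simp: Ef_def u_def\<close>)
    moreover have "cf_depth (nat a) (nat b) = Suc (cf_depth (nat (b mod a)) (nat a))"
      using cf_depth_rec[of a b] a less by simp
    ultimately show ?thesis by simp
  qed
qed

text \<open>For slopes above one, removing the integral part keeps all edges, so the first partial
  quotient of \<open>b/a\<close> pays for the vertical edge alone. Without a vertical edge it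
  remains available for a loop.\<close>

lemma card_le_cf_depth_swap:
  assumes b: "0 < b" "b < a" and E: "supporting_edges a b N E"
  shows "card E \<le> cf_depth (nat b) (nat a)"
    and "(\<And>px py ex ey. (px, py, ex, ey) \<in> E \<Longrightarrow> 0 < ex) \<Longrightarrow> card E + 1 \<le> cf_depth (nat b) (nat a)"
proof -
  define w d where "w = a div b" and "d = a mod b"
  have d: "0 \<le> d" "d < b" "d = a - w * b"
    using b by (auto simp: d_def w_def minus_div_mult_eq_mod)
  have dep: "cf_depth (nat b) (nat a) = Suc (cf_depth (nat d) (nat b))"
    using cf_depth_rec[of b a] b by (simp add: d_def)
  have nonvert: "card F \<le> cf_depth (nat d) (nat b)"
    if F: "supporting_edges a b N F" "\<And>px py ex ey. (px, py, ex, ey) \<in> F \<Longrightarrow> 0 < ex" for F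
  proof -
    obtain E2 where E2: "supporting_edges d b N E2" "card E2 = card F"
      "\<And>px py ex ey. (px, py, ex, ey) \<in> E2 \<Longrightarrow> (px, py + w * px, ex, ey + w * ex) \<in> F"
      using shear_y[OF F(1), of w] unfolding d(3) by metis
    have "0 < ex" if "(px, py, ex, ey) \<in> E2" for px py ex ey
      using E2(3)[OF that] F(2) by blast
    then show ?thesis using card_nonvertical_le_cf_depth[of d b N E2] d E2 by auto
  qed
  show "(\<And>px py ex ey. (px, py, ex, ey) \<in> E \<Longrightarrow> 0 < ex) \<Longrightarrow> card E + 1 \<le> cf_depth (nat b) (nat a)"
    using nonvert[OF E] dep by simp
  define Ev Es where "Ev = {s \<in> E. fst (snd (snd s)) = 0}" and "Es = {s \<in> E. fst (snd (snd s)) \<noteq> 0}"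
  have "card E = card Ev + card Es"
    using supporting_edges_finite[OF E] unfolding Ev_def Es_def
    by (subst card_Un_disjoint[symmetric]) (auto intro!: arg_cong[where f = card])
  moreover have "card Ev \<le> 1"
    by (rule card_vertical_le_1[of a b N]) (auto intro: supporting_edges_subset[OF E] simp: Ev_def)
  moreover have "card Es \<le> cf_depth (nat d) (nat b)"
  proof (rule nonvert)
    show "supporting_edges a b N Es" by (rule supporting_edges_subset[OF E]) (auto simp: Es_def)
    show "0 < ex" if "(px, py, ex, ey) \<in> Es" for px py ex ey
      using that supporting_edgesD(2)[OF E, of px py ex ey] by (auto simp: Es_def)
  qed
  ultimately show "card E \<le> cf_depth (nat b) (nat a)" using dep by simp
qed

text \<open>A vertical edge ends with remainder at least \<open>b\<close>, a steep one with at least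
  \<open>a\<close>. The first bound, given by the strip, excludes that both occur; the second
  excludes each of them and leaves room for a loop.\<close>

lemma card_le_cf_depth:
  assumes a: "0 < a" "a < b" and E: "supporting_edges a b N E"
  shows "(\<And>px py ex ey. (px, py, ex, ey) \<in> E \<Longrightarrow> b * (py + ey) - a * (px + ex) < a + b) \<Longrightarrow>
      card E \<le> cf_depth (nat a) (nat b)"
    and "(\<And>px py ex ey. (px, py, ex, ey) \<in> E \<Longrightarrow> b * (py + ey) - a * (px + ex) < a) \<Longrightarrow>
      card E + 1 \<le> cf_depth (nat a) (nat b)"
proof -
  define u where "u = b div a"
  have u: "u * a \<le> b" using a unfolding u_def by (metis div_mult_mod_eq le_add_same_cancel1 pos_mod_sign)
  have dep: "cf_depth (nat a) (nat b) = Suc (cf_depth (nat (b mod a)) (nat a))"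
    using cf_depth_rec[of a b] a by simp
  have shallow: "card F \<le> cf_depth (nat (b mod a)) (nat a)"
    if F: "F \<subseteq> E" "\<And>px py ex ey. (px, py, ex, ey) \<in> F \<Longrightarrow> u * ey \<le> ex" for F
  proof (rule card_shallow_le_cf_depth)
    show "supporting_edges a b N F" by (rule supporting_edges_subset[OF E F(1)])
  qed (use a F card_nonvertical_le_cf_depth in \<open>auto simp: u_def\<close>)
  have vert: "b \<le> b * (py + ey) - a * (px + ex)" "px = N"
    if "(px, py, ex, ey) \<in> E" "ex = 0" for px py ex ey
  proof -
    note D = supporting_edgesD[OF E that(1)]
    have ey: "1 \<le> ey" using D(5) that(2) a by (simp add: zero_less_mult_iff)
    have "b * 1 \<le> b * ey" using ey a by (intro mult_left_mono) auto
    then show "b \<le> b * (py + ey) - a * (px + ex)" using D(4) that(2) by (simp add: algebra_simps)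
    \<comment> \<open>The height \<open>a * N\<close> stands for any height on or above the line:
      the test of a vertical edge does not depend on it.\<close>
    have "0 \<le> - (ey * (N - px))" using D(6)[of N "a * N"] D(1,3) that(2) a
      by (simp add: mult_left_mono algebra_simps)
    then have "N \<le> px" using ey by (smt (verit) mult_pos_pos)
    then show "px = N" using D(3) that(2) by simp
  qed
  show "card E + 1 \<le> cf_depth (nat a) (nat b)"
    if small: "\<And>px py ex ey. (px, py, ex, ey) \<in> E \<Longrightarrow> b * (py + ey) - a * (px + ex) < a"
  proof -
    have "u * ey \<le> ex" if e: "(px, py, ex, ey) \<in> E" for px py ex ey
    proof (rule ccontr)
      assume "\<not> u * ey \<le> ex"
      then show False
        using steep_edge(3)[OF E e a(1) u] vert(1)[OF e] small[OF e] supporting_edgesD(2)[OF E e] a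
        by (cases "ex = 0") auto
    qed
    then show ?thesis using shallow[of E] dep by simp
  qed
  show "card E \<le> cf_depth (nat a) (nat b)"
    if bnd: "\<And>px py ex ey. (px, py, ex, ey) \<in> E \<Longrightarrow> b * (py + ey) - a * (px + ex) < a + b"
  proof (cases "\<exists>px py ey. (px, py, 0, ey) \<in> E")
    case False
    then have "0 < ex" if "(px, py, ex, ey) \<in> E" for px py ex ey
      using that supporting_edgesD(2)[OF E that] by (cases "ex = 0") auto
    then show ?thesis using card_nonvertical_le_cf_depth[of a b N E] a E by auto
  next
    case True
    then obtain vx vy vz where v: "(vx, vy, 0, vz) \<in> E" by auto
    note V = supporting_edgesD[OF E v]
    have sh: "u * ey \<le> ex" if e: "(px, py, ex, ey) \<in> E" "ex \<noteq> 0" for px py ex ey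
    proof (rule ccontr)
      assume *: "\<not> u * ey \<le> ex"
      note D = supporting_edgesD[OF E e(1)]
      have ex: "0 < ex" using D(2) e(2) by simp
      note st = steep_edge[OF E e(1) a(1) u]
      \<comment> \<open>Tested at the start of the vertical edge, the steep edge must end at or
        below it, so the two remainders add up.\<close>
      have "0 \<le> ex * (vy - py) - ey * (vx - px)" using D(6)[of vx vy] V(1,3,4) by simp
      then have "0 \<le> ex * (vy - (py + ey))"
        using st ex * a vert(2)[OF v] by (simp add: algebra_simps)
      then have "py + ey \<le> vy" using ex by (simp add: zero_le_mult_iff)
      then have "b * (py + ey) \<le> b * vy" using a by simp
      moreover have "a \<le> b * (py + ey) - a * N" using st(2,3) ex * a by simp
      moreover have "1 \<le> vz" using V(5) a by (simp add: zero_less_mult_iff)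
      then have "b * 1 \<le> b * vz" using a by (intro mult_left_mono) auto
      ultimately have "a + b \<le> b * (vy + vz) - a * (vx + 0)"
        using vert(2)[OF v] by (simp add: algebra_simps)
      then show False using bnd[OF v] by simp
    qed
    define Ev Es where "Ev = {s \<in> E. fst (snd (snd s)) = 0}" and "Es = {s \<in> E. fst (snd (snd s)) \<noteq> 0}"
    have "card E = card Ev + card Es"
      using supporting_edges_finite[OF E] unfolding Ev_def Es_def
      by (subst card_Un_disjoint[symmetric]) (auto intro!: arg_cong[where f = card])
    moreover have "card Ev \<le> 1"
      by (rule card_vertical_le_1[of a b N]) (auto intro: supporting_edges_subset[OF E] simp: Ev_def)
    moreover have "card Es \<le> cf_depth (nat (b mod a)) (nat a)"
      by (rule shallow) (use sh in \<open>auto simp: Es_def\<close>)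
    ultimately show ?thesis using dep by simp
  qed
qed

section \<open>Walks in a standard line\<close>

lemma int_walk_intermediate:
  fixes T :: "int \<Rightarrow> int"
  assumes step: "\<And>k. \<bar>T (k + 1) - T k\<bar> = 1" and "k \<le> m"
    and "T k \<le> s \<and> s \<le> T m \<or> T m \<le> s \<and> s \<le> T k"
  shows "\<exists>n. k \<le> n \<and> n \<le> m \<and> T n = s"
  using assms(2,3)
proof (induction m rule: int_ge_induct)
  case base
  then show ?case by auto
next
  case (step m)
  show ?case
  proof (cases "s = T (m + 1)")
    case True
    then show ?thesis using step(1) by (intro exI[of _ "m + 1"]) auto
  next
    case False
    then have "T k \<le> s \<and> s \<le> T m \<or> T m \<le> s \<and> s \<le> T k"
      using step(3) assms(1)[of m] by linarith
    then show ?thesis using step(2) by force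
  qed
qed

text \<open>In the half-plane of positive coordinate sum, turning clockwise is transitive, by a
  three-term identity between the cross products. So \<open>F\<close>, \<open>D\<close>,
  \<open>C\<close> in clockwise order contradict a strict counterclockwise turn from
  \<open>F\<close> to \<open>C\<close>.\<close>

lemma quadrant_parallel:
  fixes Fx Fy Dx Dy Cx Cy :: int
  assumes "0 < Fx + Fy" "0 < Dx + Dy" "0 < Cx + Cy"
    and "Fx * Dy - Fy * Dx \<le> 0" "Dx * Cy - Dy * Cx \<le> 0" "0 \<le> Fx * Cy - Fy * Cx"
  shows "Fx * Cy - Fy * Cx = 0"
proof -
  have "(Fx * Dy - Fy * Dx) * (Cx + Cy) + (Dx * Cy - Dy * Cx) * (Fx + Fy) =
      (Fx * Cy - Fy * Cx) * (Dx + Dy)" by algebra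
  moreover have "(Fx * Dy - Fy * Dx) * (Cx + Cy) \<le> 0" "(Dx * Cy - Dy * Cx) * (Fx + Fy) \<le> 0"
    using assms by (auto intro!: mult_nonpos_nonneg)
  ultimately have "(Fx * Cy - Fy * Cx) * (Dx + Dy) \<le> 0" by linarith
  then show ?thesis using assms by (smt (verit) mult_pos_pos)
qed

lemma quadrant_parallel_dot_pos:
  fixes Fx Fy Cx Cy :: int
  assumes "0 \<le> Fx" "0 \<le> Fy" "0 \<le> Cx" "0 \<le> Cy" "0 < Fx + Fy" "0 < Cx + Cy"
    and "Fx * Cy = Fy * Cx"
  shows "0 < Fx * Cx + Fy * Cy"
proof (rule ccontr)
  assume "\<not> 0 < Fx * Cx + Fy * Cy"
  moreover have "0 \<le> Fx * Cx" "0 \<le> Fy * Cy" using assms by auto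
  ultimately have "Fx * Cx = 0" "Fy * Cy = 0" by linarith+
  then show False using assms by auto
qed

lemma finite_int_interval_pred [simp]:
  "finite {k :: int. l \<le> k \<and> k < m \<and> P k}" "finite {k :: int. l \<le> k \<and> k \<le> m \<and> P k}"
  "finite {k :: int. l < k \<and> k \<le> m \<and> P k}"
  by (rule finite_subset[of _ "{l..m}"]; auto)+

text \<open>The walk in coordinates in which the standard line has positive coefficients; \<open>v\<close> marks the
  times at which it is at a vertex. In the strip, a point is determined by \<open>X + Y\<close>.\<close>

locale strip_walk =
  fixes X Y :: "int \<Rightarrow> int" and v :: "int \<Rightarrow> bool" and i j p q a b \<mu> :: int
  assumes a_pos: "0 < a" and b_pos: "0 < b"
    and adj: "\<And>k. \<bar>X k - X (k + 1)\<bar> + \<bar>Y k - Y (k + 1)\<bar> = 1"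
    and strip: "\<And>k. i \<le> k \<Longrightarrow> k \<le> j \<Longrightarrow> \<mu> \<le> a * X k - b * Y k \<and> a * X k - b * Y k < \<mu> + a + b"
    and same_v: "\<And>k m. X k = X m \<Longrightarrow> Y k = Y m \<Longrightarrow> v k = v m"
    and edge_right: "\<And>k k' m. i \<le> k \<Longrightarrow> k < k' \<Longrightarrow> k' \<le> j \<Longrightarrow> v k \<Longrightarrow> v k' \<Longrightarrow>
        \<forall>m. k < m \<and> m < k' \<longrightarrow> \<not> v m \<Longrightarrow> X k \<noteq> X k' \<or> Y k \<noteq> Y k' \<Longrightarrow>
        (X k' - X k) * (Y m - Y k) - (Y k' - Y k) * (X m - X k) \<le> 0"
    and spur: "\<And>m m'. i \<le> m \<Longrightarrow> m \<le> j \<Longrightarrow> i \<le> m' \<Longrightarrow> m' \<le> j \<Longrightarrow>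
        X (m - 1) = X (m + 1) \<Longrightarrow> Y (m - 1) = Y (m + 1) \<Longrightarrow> \<not> v m \<Longrightarrow>
        X m' = X m \<Longrightarrow> Y m' = Y m \<Longrightarrow> m' = m"
    and extreme: "\<And>k m m'. v k \<Longrightarrow>
        (X m - X k) * (Y m' - Y k) - (Y m - Y k) * (X m' - X k) = 0 \<Longrightarrow>
        0 \<le> (X m - X k) * (X m' - X k) + (Y m - Y k) * (Y m' - Y k)"
    and bounds: "i \<le> p" "p < q" "q \<le> j"
    and vp: "v p" and vq: "v q" and no_v: "\<And>m. p < m \<Longrightarrow> m < q \<Longrightarrow> \<not> v m"
    and upper_p: "a * X p - b * Y p = \<mu>" and upper_q: "a * X q - b * Y q = \<mu>"
    and not_upper: "\<And>k. i \<le> k \<Longrightarrow> k < p \<Longrightarrow> a * X k - b * Y k \<noteq> \<mu>"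
begin

text \<open>\<open>T\<close> is the position along the strip and changes by one at each step;
  \<open>R\<close> is the remainder, zero exactly on the upper leaning line.\<close>

definition T :: "int \<Rightarrow> int" where "T k = X k + Y k"
definition R :: "int \<Rightarrow> int" where "R k = a * X k - b * Y k - \<mu>"

lemma T_step: "\<bar>T (k + 1) - T k\<bar> = 1"
  using adj[of k] unfolding T_def by linarith

lemma R_bounds: "i \<le> k \<Longrightarrow> k \<le> j \<Longrightarrow> 0 \<le> R k \<and> R k < a + b"
  using strip[of k] unfolding R_def by linarith

lemma R_p: "R p = 0" and R_q: "R q = 0"
  using upper_p upper_q by (simp_all add: R_def)

lemma R_pos: "i \<le> k \<Longrightarrow> k < p \<Longrightarrow> 0 < R k"
  using not_upper[of k] R_bounds[of k] bounds by (simp add: R_def)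

text \<open>Along an antidiagonal \<open>a * x - b * y\<close> changes by multiples of
  \<open>a + b\<close>, the width of the strip.\<close>

lemma strip_point_unique:
  assumes "i \<le> k" "k \<le> j" "T k = x + y" "\<mu> \<le> a * x - b * y" "a * x - b * y < \<mu> + a + b"
  shows "X k = x" "Y k = y"
proof -
  have "R k - (a * x - b * y - \<mu>) = (a + b) * (X k - x)"
    using assms(3) unfolding R_def T_def by algebra
  moreover have "\<bar>R k - (a * x - b * y - \<mu>)\<bar> < a + b"
    using R_bounds[OF assms(1,2)] assms(4,5) by linarith
  ultimately have "(a + b) * \<bar>X k - x\<bar> < (a + b) * 1"
    using a_pos b_pos by (simp add: abs_mult)
  then have "\<bar>X k - x\<bar> < 1" using a_pos b_pos by (simp add: mult_less_cancel_left)
  then show "X k = x" "Y k = y" using assms(3) unfolding T_def by linarith+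
qed

lemma strip_unique:
  assumes "i \<le> k" "k \<le> j" "i \<le> m" "m \<le> j" "T k = T m"
  shows "X k = X m" "Y k = Y m" "v k = v m" "R k = R m"
proof -
  show xy: "X k = X m" "Y k = Y m"
    by (intro strip_point_unique; use assms strip[of m] in \<open>auto simp: T_def\<close>)+
  show "v k = v m" using same_v xy by blast
  show "R k = R m" using xy by (simp add: R_def)
qed

text \<open>Opposite changes of the two coordinates would change the remainder by at least
  \<open>a + b\<close>.\<close>

lemma strip_mono:
  assumes "i \<le> k" "k \<le> j" "i \<le> m" "m \<le> j" "T k \<le> T m"
  shows "X k \<le> X m" "Y k \<le> Y m"
proof -
  note B = R_bounds[OF assms(1,2)] R_bounds[OF assms(3,4)]
  have eq: "R m - R k = a * (X m - X k) - b * (Y m - Y k)" by (simp add: R_def algebra_simps)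
  show "X k \<le> X m"
  proof (rule ccontr)
    assume "\<not> X k \<le> X m"
    then have "X m - X k \<le> -1" "1 \<le> Y m - Y k" using assms(5) by (auto simp: T_def)
    then have "a * (X m - X k) \<le> a * (-1)" "b * 1 \<le> b * (Y m - Y k)"
      using a_pos b_pos by (intro mult_left_mono; simp)+
    then show False using eq B by linarith
  qed
  show "Y k \<le> Y m"
  proof (rule ccontr)
    assume "\<not> Y k \<le> Y m"
    then have "Y m - Y k \<le> -1" "1 \<le> X m - X k" using assms(5) by (auto simp: T_def)
    then have "b * (Y m - Y k) \<le> b * (-1)" "a * 1 \<le> a * (X m - X k)"
      using a_pos b_pos by (intro mult_left_mono; simp)+
    then show False using eq B by linarith
  qed
qed

lemma intermediate:
  assumes "k \<le> m" "T k \<le> s \<and> s \<le> T m \<or> T m \<le> s \<and> s \<le> T k"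
  obtains n where "k \<le> n" "n \<le> m" "T n = s"
  using int_walk_intermediate[of T k m s] T_step assms by blast

section \<open>Arrival at the first upper leaning point\<close>

lemma T_ne_p: "i \<le> k \<Longrightarrow> k < p \<Longrightarrow> T k \<noteq> T p"
  using strip_unique(4)[of k p] R_pos[of k] R_p bounds by force

lemma turning_point:
  assumes "i < m" "m < j" "T (m - 1) = T (m + 1)" "\<not> v m" "i \<le> m'" "m' \<le> j" "T m' = T m"
  shows "m' = m"
  using spur[of m m'] strip_unique(1,2)[of "m - 1" "m + 1"] strip_unique(1,2)[of m' m] assms by simp

lemma arrival_from_above:
  assumes k: "i \<le> k" "k < p" "T p < T k" and m: "i \<le> m" "m < p"
  shows "T p < T m"
proof (rule ccontr)
  assume "\<not> T p < T m"
  then have "T m < T p" using T_ne_p m by force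
  have "T (min k m) \<le> T p \<and> T p \<le> T (max k m) \<or> T (max k m) \<le> T p \<and> T p \<le> T (min k m)"
    using \<open>T m < T p\<close> k(3) by (cases "k \<le> m") (auto simp: min_def max_def)
  then obtain n where n: "min k m \<le> n" "n \<le> max k m" "T n = T p"
    by (rule intermediate[of "min k m" "max k m" "T p", rotated]) auto
  have "i \<le> n" "n < p" using n(1,2) k(1,2) m by linarith+
  then show False using T_ne_p n(3) by blast
qed

text \<open>The walk comes down to \<open>p\<close>. An edge to a lower \<open>q\<close> would have
  the point before \<open>p\<close> strictly on its left; an edge to a higher \<open>q\<close> would
  pass through the earlier vertex; a loop at \<open>p\<close> would conflict with the edge leading
  to \<open>p\<close> or retrace it.\<close>

lemma no_vertex_if_above:
  assumes k: "i \<le> k" "k < p" "T p < T k" and m: "i \<le> m" "m < p"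
  shows "\<not> v m"
proof
  assume "v m"
  note above = arrival_from_above[OF k]
  have prev: "X (p - 1) = X p + 1" "Y (p - 1) = Y p"
  proof -
    have r: "i \<le> p - 1" "p - 1 < p" using k by auto
    have "T (p - 1) = T p + 1" using above[OF r] T_step[of "p - 1"] by auto
    moreover have "\<mu> \<le> a * (X p + 1) - b * Y p" "a * (X p + 1) - b * Y p < \<mu> + a + b"
      using upper_p a_pos b_pos by (simp_all add: algebra_simps)
    ultimately show "X (p - 1) = X p + 1" "Y (p - 1) = Y p"
      by (intro strip_point_unique; use r bounds in \<open>simp add: T_def\<close>)+
  qed
  show False
  proof (cases "T q = T p")
    case False
    have dist: "X p \<noteq> X q \<or> Y p \<noteq> Y q" using False by (auto simp: T_def)
    show False
    proof (cases "T q < T p")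
      case True
      have "(X q - X p) * (Y (p - 1) - Y p) - (Y q - Y p) * (X (p - 1) - X p) \<le> 0"
        by (rule edge_right) (use bounds vp vq no_v dist in auto)
      then have "Y p \<le> Y q" using prev by simp
      moreover have "X q \<le> X p" "Y q \<le> Y p" using strip_mono[of q p] True bounds by auto
      moreover have "a * (X q - X p) = b * (Y q - Y p)" using upper_p upper_q by (simp add: algebra_simps)
      ultimately have "X q = X p" "Y q = Y p" using a_pos by auto
      then show False using dist by simp
    next
      case False
      then have "T p < T q" using \<open>T q \<noteq> T p\<close> by simp
      \<comment> \<open>Otherwise the point of \<open>q\<close>, which is upper leaning, would be
        met before time \<open>p\<close>.\<close>
      have "T m < T q"
      proof (rule ccontr)
        assume "\<not> T m < T q"
        then obtain n where n: "m \<le> n" "n \<le> p" "T n = T q"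
          using intermediate[of m p "T q"] \<open>T p < T q\<close> m by auto
        then have "n < p" using \<open>T p < T q\<close> by (cases "n = p") auto
        then show False using strip_unique(4)[of n q] R_pos[of n] R_q n m bounds by auto
      qed
      then obtain n where n: "p \<le> n" "n \<le> q" "T n = T m"
        using intermediate[of p q "T m"] above[OF m] bounds by auto
      then have "v n" using strip_unique(3)[of n m] \<open>v m\<close> m bounds by auto
      moreover have "p < n" "n < q" using n above[OF m] \<open>T m < T q\<close> by (auto simp: order_less_le)
      ultimately show False using no_v by blast
    qed
  next
    case True
    define A where "A = {n. i \<le> n \<and> n < p \<and> v n}"
    define kx where "kx = Max A"
    have fA: "finite A" by (simp add: A_def)
    have "m \<in> A" using m \<open>v m\<close> by (simp add: A_def)
    then have "kx \<in> A" unfolding kx_def using fA Max_in by blast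
    then have kx: "i \<le> kx" "kx < p" "v kx" by (auto simp: A_def)
    have kx_last: "\<not> v n" if "kx < n" "n < p" for n
    proof
      assume "v n"
      then have "n \<in> A" using that kx by (simp add: A_def)
      then show False using Max_ge[OF fA] that unfolding kx_def by fastforce
    qed
    have Tkx: "T p < T kx" using above kx by blast
    have interior: "T n \<noteq> T p" if "p < n" "n < q" for n
      using strip_unique(3)[of n p] no_v[OF that] that vp bounds by auto
    have pq: "p + 1 < q" using True T_step[of p] bounds by (cases "q = p + 1") auto
    show False
    proof (cases "T (p + 1) < T p")
      case True
      have "T (p + 1) = T p - 1" using True T_step[of p] by linarith
      moreover have "\<mu> \<le> a * X p - b * (Y p - 1)" "a * X p - b * (Y p - 1) < \<mu> + a + b"
        using upper_p a_pos b_pos by (simp_all add: algebra_simps)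
      ultimately have nxt: "X (p + 1) = X p" "Y (p + 1) = Y p - 1"
        by (intro strip_point_unique; use bounds in \<open>simp add: T_def\<close>)+
      have E: "(X p - X kx) * (Y n - Y kx) - (Y p - Y kx) * (X n - X kx) \<le> 0" for n
        by (rule edge_right) (use kx kx_last bounds vp Tkx in \<open>auto simp: T_def\<close>)
      have "X kx \<le> X p" using E[of "p + 1"] unfolding nxt by (simp add: algebra_simps)
      moreover have "Y kx \<le> Y p" using E[of "p - 1"] unfolding prev by (simp add: algebra_simps)
      ultimately show False using Tkx by (simp add: T_def)
    next
      case False
      then have Tp1: "T p < T (p + 1)" using T_step[of p] by linarith
      \<comment> \<open>The farthest point of the loop is a turning point, but the walk meets it
        already between \<open>kx\<close> and \<open>p\<close>.\<close>
      define M where "M = Max (T ` {p..q})"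
      have "M \<in> T ` {p..q}" unfolding M_def using bounds by (intro Max_in) auto
      then obtain z where z: "p \<le> z" "z \<le> q" "T z = M" by auto
      have M_ge: "T n \<le> T z" if "p \<le> n" "n \<le> q" for n
        unfolding z(3) M_def using that by (intro Max_ge) auto
      have "T p < T z" using M_ge[of "p + 1"] pq Tp1 by simp
      then have zin: "p < z" "z < q" using z \<open>T q = T p\<close> by (auto simp: order_less_le)
      have "T (z - 1) \<le> T z" "T (z + 1) \<le> T z" using M_ge zin by simp_all
      then have tz: "T (z - 1) = T (z + 1)"
        using T_step[of z] T_step[of "z - 1"] unfolding diff_add_cancel by linarith
      have "T z < T kx"
      proof (rule ccontr)
        assume "\<not> T z < T kx"
        then obtain n where n: "p \<le> n" "n \<le> z" "T n = T kx"
          using intermediate[of p z "T kx"] Tkx z by auto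
        then have "v n" using strip_unique(3)[of n kx] kx zin bounds by auto
        moreover have "p < n" using n Tkx by (cases "n = p") auto
        ultimately show False using no_v n zin by force
      qed
      then obtain n where n: "kx \<le> n" "n \<le> p" "T n = T z"
        using intermediate[of kx p "T z"] \<open>T p < T z\<close> kx by auto
      have "n = z" by (rule turning_point) (use zin tz no_v n kx bounds in auto)
      then show False using n zin by simp
    qed
  qed
qed

end

text \<open>Before \<open>p\<close> the walk stays on one side of \<open>T p\<close>; this is the
  side not settled by \<open>no_vertex_if_above\<close>.\<close>

locale forward_strip_walk = strip_walk +
  assumes below: "\<And>k. i \<le> k \<Longrightarrow> k < p \<Longrightarrow> T k < T p"
begin

section \<open>Convexity of the vertex chain\<close>

definition consecutive :: "int \<Rightarrow> int \<Rightarrow> bool" where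
  "consecutive k k' \<longleftrightarrow> i \<le> k \<and> k < k' \<and> k' \<le> p \<and> v k \<and> v k' \<and> (\<forall>m. k < m \<and> m < k' \<longrightarrow> \<not> v m)"

lemma consecutiveD:
  assumes "consecutive k k'"
  shows "i \<le> k" "k < k'" "k' \<le> p" "k < p" "k \<le> j" "i \<le> k'" "k' \<le> j" "v k" "v k'"
    "\<And>m. k < m \<Longrightarrow> m < k' \<Longrightarrow> \<not> v m"
  using assms bounds by (auto simp: consecutive_def)

lemma consecutive_edge_right:
  assumes "consecutive k k'" "T k \<noteq> T k'"
  shows "(X k' - X k) * (Y m - Y k) - (Y k' - Y k) * (X m - X k) \<le> 0"
  by (rule edge_right) (use consecutiveD[OF assms(1)] assms(2) in \<open>auto simp: T_def\<close>)

definition nxt :: "int \<Rightarrow> int" where "nxt k = Min {k'. k < k' \<and> k' \<le> p \<and> v k'}"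

lemma nxt:
  assumes "i \<le> k" "k < p" "v k"
  shows "consecutive k (nxt k)" "\<And>m. k < m \<Longrightarrow> m \<le> p \<Longrightarrow> v m \<Longrightarrow> nxt k \<le> m"
proof -
  define A where "A = {k'. k < k' \<and> k' \<le> p \<and> v k'}"
  have fA: "finite A" by (simp add: A_def)
  have "p \<in> A" using assms vp by (simp add: A_def)
  then have "nxt k \<in> A" unfolding nxt_def A_def[symmetric] using fA Min_in by blast
  moreover show le: "nxt k \<le> m" if "k < m" "m \<le> p" "v m" for m
    unfolding nxt_def A_def[symmetric] by (rule Min_le) (use fA that in \<open>auto simp: A_def\<close>)
  ultimately show "consecutive k (nxt k)"
    using assms unfolding consecutive_def A_def by force
qed

text \<open>After a step backwards the walk has to return to the same vertex on its way to \<open>p\<close>;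
  the outgoing edge and the edge of the return would then make that vertex non-extreme.\<close>

lemma consecutive_T_le:
  assumes "consecutive k k'"
  shows "T k \<le> T k'"
proof (rule ccontr)
  assume "\<not> T k \<le> T k'"
  then have bwd: "T k' < T k" by simp
  note C = consecutiveD[OF assms]
  have Tk: "T k < T p" using below C by simp
  then have "k' \<noteq> p" using bwd by auto
  then have k'p: "k' < p" using C by simp
  define A where "A = {n. k' \<le> n \<and> n \<le> p \<and> T n = T k}"
  \<comment> \<open>\<open>r\<close> is the first return to the vertex of \<open>k\<close>, and
    \<open>s\<close> below is the last visit to a vertex before \<open>r\<close>, so the returning
    edge runs from \<open>s\<close> to \<open>r\<close>.\<close>
  define r where "r = Min A"
  have fA: "finite A" by (simp add: A_def)
  obtain n where "k' \<le> n" "n \<le> p" "T n = T k"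
    using intermediate[of k' p "T k"] bwd Tk k'p by auto
  then have "n \<in> A" by (simp add: A_def)
  then have "r \<in> A" unfolding r_def using fA Min_in by blast
  then have r: "k' \<le> r" "r \<le> p" "T r = T k" by (auto simp: A_def)
  have r_first: "T n \<noteq> T k" if "k' \<le> n" "n < r" for n
  proof
    assume "T n = T k"
    then have "n \<in> A" using that r by (simp add: A_def)
    then have "r \<le> n" unfolding r_def using fA by simp
    then show False using that by simp
  qed
  have r_below: "T n < T k" if n: "k' \<le> n" "n < r" for n
  proof (rule ccontr)
    assume "\<not> T n < T k"
    then obtain n' where "k' \<le> n'" "n' \<le> n" "T n' = T k"
      using intermediate[of k' n "T k"] bwd n by auto
    then show False using r_first[of n'] n by simp
  qed
  have "r \<noteq> k'" "r \<noteq> p" using r bwd Tk by auto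
  then have rs: "k' < r" "r < p" using r by auto
  define B where "B = {n. k' \<le> n \<and> n < r \<and> v n}"
  define s where "s = Max B"
  have fB: "finite B" by (simp add: B_def)
  have "k' \<in> B" using C rs by (simp add: B_def)
  then have "s \<in> B" unfolding s_def using fB Max_in by blast
  then have s: "k' \<le> s" "s < r" "v s" by (auto simp: B_def)
  have s_last: "\<not> v n" if "s < n" "n < r" for n
  proof
    assume "v n"
    then have "n \<in> B" using that s by (simp add: B_def)
    then have "n \<le> s" unfolding s_def using fB by simp
    then show False using that by simp
  qed
  have kr: "X r = X k" "Y r = Y k" "v r = v k"
    using strip_unique[of r k] r rs C bounds by auto
  have sr: "consecutive s r"
    using s s_last rs kr C by (auto simp: consecutive_def)
  have Ts: "T s < T k" using r_below s by simp
  \<comment> \<open>\<open>F\<close> and \<open>D\<close> lead to the vertex from \<open>k'\<close>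
    and \<open>s\<close>, and \<open>C\<close> leads on to \<open>p\<close>. The support conditions
    make \<open>F\<close> and \<open>C\<close> parallel, which puts the vertex strictly between
    \<open>k'\<close> and \<open>p\<close>.\<close>
  define Fx Fy Dx Dy Cx Cy where "Fx = X k - X k'" and "Fy = Y k - Y k'"
    and "Dx = X k - X s" and "Dy = Y k - Y s" and "Cx = X p - X k" and "Cy = Y p - Y k"
  note defs = Fx_def Fy_def Dx_def Dy_def Cx_def Cy_def
  have pos: "0 < Fx + Fy" "0 < Dx + Dy" "0 < Cx + Cy"
    using bwd Ts Tk by (auto simp: defs T_def)
  have "0 \<le> Fx * Cy - Fy * Cx"
    using consecutive_edge_right[OF assms, of p] bwd unfolding defs by (simp add: algebra_simps)
  moreover have "Fx * Dy - Fy * Dx \<le> 0"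
    using consecutive_edge_right[OF assms, of s] bwd unfolding defs by (simp add: algebra_simps)
  moreover have "Dx * Cy - Dy * Cx \<le> 0"
    using consecutive_edge_right[OF sr, of p] Ts r(3) unfolding defs kr by (simp add: algebra_simps)
  ultimately have par: "Fx * Cy - Fy * Cx = 0" using quadrant_parallel pos by blast
  have "0 \<le> Fx" "0 \<le> Fy" using strip_mono[of k' k] bwd C by (auto simp: defs)
  moreover have "0 \<le> Cx" "0 \<le> Cy" using strip_mono[of k p] Tk C bounds by (auto simp: defs)
  ultimately have "0 < Fx * Cx + Fy * Cy"
    using quadrant_parallel_dot_pos[of Fx Fy Cx Cy] pos par by simp
  moreover have "(X k' - X k) * (Y p - Y k) - (Y k' - Y k) * (X p - X k) = 0"
    using par unfolding defs by (simp add: algebra_simps)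
  note extreme[OF C(8) this]
  ultimately show False unfolding defs by (simp add: algebra_simps)
qed

lemma vertex_chain_induct:
  assumes "i \<le> k" "v k" "k \<le> m" "m \<le> p" "v m"
    and refl: "\<And>k. P k k" and step: "\<And>k k' m. consecutive k k' \<Longrightarrow> P k' m \<Longrightarrow> P k m"
  shows "P k m"
  using assms(1-5)
proof (induction "nat (m - k)" arbitrary: k rule: less_induct)
  case less
  show ?case
  proof (cases "k = m")
    case True
    then show ?thesis using refl by simp
  next
    case False
    then have n: "consecutive k (nxt k)" "nxt k \<le> m" using nxt[of k] less by auto
    note C = consecutiveD[OF n(1)]
    have "P (nxt k) m" by (rule less(1)) (use n C less in auto)
    then show ?thesis using step n by blast
  qed
qed

lemma vertex_T_mono:
  assumes "i \<le> k" "v k" "k \<le> m" "m \<le> p" "v m"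
  shows "T k \<le> T m"
  using assms by (rule vertex_chain_induct) (use consecutive_T_le order_trans in blast)+

lemma consecutive_mono:
  assumes "consecutive k k'"
  shows "X k \<le> X k'" "Y k \<le> Y k'"
  using strip_mono[of k k'] consecutiveD[OF assms] consecutive_T_le[OF assms] by auto

text \<open>The way from \<open>k'\<close> to \<open>p\<close> ends with remainder zero, so for
  \<open>k' < p\<close> it is steeper than the line. As \<open>p\<close> lies to the right of the
  edge, the edge is at least as steep as this way.\<close>

lemma consecutive_R_less:
  assumes "consecutive k k'" "T k \<noteq> T k'"
  shows "R k' < R k"
proof -
  note C = consecutiveD[OF assms(1)]
  show ?thesis
  proof (cases "k' = p")
    case True
    then show ?thesis using R_p R_pos C by simp
  next
    case False
    then have k'p: "k' < p" using C by simp
    define ex ey px py where "ex = X k' - X k" and "ey = Y k' - Y k"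
      and "px = X p - X k'" and "py = Y p - Y k'"
    note defs = ex_def ey_def px_def py_def
    have nonneg: "0 \<le> ex" "0 \<le> ey" "0 \<le> px" "0 \<le> py"
      using consecutive_mono[OF assms(1)] strip_mono[of k' p] below[of k'] k'p C bounds
      by (auto simp: defs)
    have pos: "0 < ex + ey" using assms(2) nonneg by (auto simp: defs T_def)
    have cr: "ex * py \<le> ey * px"
      using consecutive_edge_right[OF assms, of p] unfolding defs by (simp add: algebra_simps)
    have "R k' = b * py - a * px" using R_p by (simp add: R_def defs algebra_simps)
    then have rp: "a * px < b * py" using R_pos[of k'] k'p C by simp
    have "a * ex < b * ey"
    proof (cases "ex = 0")
      case True
      then show ?thesis using pos b_pos by simp
    next
      case ex: False
      then have "0 < ex" using nonneg by simp
      then have "ex * (a * px) < ex * (b * py)" using rp by simp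
      moreover have "b * (ex * py) \<le> b * (ey * px)" using cr b_pos by simp
      ultimately have lt: "(a * ex) * px < (b * ey) * px" by (simp add: algebra_simps)
      then show ?thesis using nonneg(3) by (simp add: mult_less_cancel_right)
    qed
    moreover have "R k - R k' = b * ey - a * ex" by (simp add: R_def defs algebra_simps)
    ultimately show ?thesis by simp
  qed
qed

lemma vertex_R_mono:
  assumes "i \<le> k" "v k" "k \<le> m" "m \<le> p" "v m"
  shows "R m \<le> R k"
  using assms
proof (rule vertex_chain_induct)
  fix k k' m assume *: "consecutive k k'" "R m \<le> R k'"
  note C = consecutiveD[OF *(1)]
  show "R m \<le> R k"
  proof (cases "T k = T k'")
    case True
    then show ?thesis using * strip_unique(4)[of k k'] C by auto
  next
    case False
    then show ?thesis using * consecutive_R_less by fastforce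
  qed
qed simp

section \<open>Proper edges and loops\<close>

text \<open>A walk may visit the same vertex twice in a row; these visits form \<open>loops\<close>.\<close>

definition proper :: "int set" where "proper = {k. i \<le> k \<and> k < p \<and> v k \<and> T (nxt k) \<noteq> T k}"
definition loops :: "int set" where "loops = {k. i \<le> k \<and> k < p \<and> v k \<and> T (nxt k) = T k}"

lemma properD:
  assumes "k \<in> proper"
  shows "consecutive k (nxt k)" "T k \<noteq> T (nxt k)" "T k < T (nxt k)"
  using assms nxt(1)[of k] consecutive_T_le[of k "nxt k"] by (auto simp: proper_def)

lemma loopsD:
  assumes "k \<in> loops"
  shows "consecutive k (nxt k)" "T (nxt k) = T k" "nxt k < p"
proof -
  show "consecutive k (nxt k)" "T (nxt k) = T k" using assms nxt(1)[of k] by (auto simp: loops_def)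
  then show "nxt k < p"
    using consecutiveD[of k "nxt k"] T_ne_p[of k] by (cases "nxt k = p") auto
qed

text \<open>Two parallel edges that support each other lie on one line. Then the end of the earlier
  edge lies strictly between its start and the end of the later edge, so it is not extreme.\<close>

lemma proper_not_parallel:
  assumes k: "k \<in> proper" and m: "m \<in> proper" and "k < m"
  shows "(X (nxt k) - X k) * (Y (nxt m) - Y m) \<noteq> (Y (nxt k) - Y k) * (X (nxt m) - X m)"
proof
  assume par: "(X (nxt k) - X k) * (Y (nxt m) - Y m) = (Y (nxt k) - Y k) * (X (nxt m) - X m)"
  note K = consecutiveD[OF properD(1)[OF k]] and M = consecutiveD[OF properD(1)[OF m]]
  have "nxt k \<le> m" using nxt(2)[of k m] K M \<open>k < m\<close> by auto
  then have Tkm: "T (nxt k) \<le> T m" using vertex_T_mono[of "nxt k" m] K M by auto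
  define ex ey fx fy wx wy where "ex = X (nxt k) - X k" and "ey = Y (nxt k) - Y k"
    and "fx = X (nxt m) - X m" and "fy = Y (nxt m) - Y m" and "wx = X m - X k" and "wy = Y m - Y k"
  note defs = ex_def ey_def fx_def fy_def wx_def wy_def
  have pos: "0 < ex + ey" "0 < fx + fy" using properD(3)[OF k] properD(3)[OF m] by (auto simp: defs T_def)
  have nonneg: "0 \<le> ex" "0 \<le> ey" "0 \<le> fx" "0 \<le> fy"
    using consecutive_mono[OF properD(1)[OF k]] consecutive_mono[OF properD(1)[OF m]] by (auto simp: defs)
  have e: "ex * fy = ey * fx" using par by (simp add: defs)
  have 1: "ex * wy - ey * wx \<le> 0"
    using consecutive_edge_right[OF properD(1,2)[OF k], of m] by (simp add: defs)
  have 2: "0 \<le> fx * wy - fy * wx"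
    using consecutive_edge_right[OF properD(1,2)[OF m], of k] by (simp add: defs algebra_simps)
  have "(ex * wy - ey * wx) * (fx + fy) = (fx * wy - fy * wx) * (ex + ey)" using e by algebra
  moreover have "(ex * wy - ey * wx) * (fx + fy) \<le> 0" using 1 pos by (simp add: mult_nonpos_nonneg)
  moreover have "0 \<le> (fx * wy - fy * wx) * (ex + ey)" using 2 pos by simp
  ultimately have "(ex * wy - ey * wx) * (fx + fy) = 0" by linarith
  then have w: "ex * wy = ey * wx" using pos by simp
  define zx zy where "zx = X (nxt m) - X (nxt k)" and "zy = Y (nxt m) - Y (nxt k)"
  have z: "zx = wx + fx - ex" "zy = wy + fy - ey" by (simp_all add: zx_def zy_def defs)
  have "T (nxt k) < T (nxt m)" using Tkm properD(3)[OF m] by simp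
  then have zn: "0 \<le> zx" "0 \<le> zy" "0 < zx + zy"
    using strip_mono[of "nxt k" "nxt m"] K M by (auto simp: zx_def zy_def T_def)
  have ez: "ex * zy = ey * zx" using w e z by algebra
  have "0 < ex * zx + ey * zy"
    by (rule quadrant_parallel_dot_pos) (use pos nonneg zn ez in auto)
  moreover have "(X k - X (nxt k)) * (Y (nxt m) - Y (nxt k)) - (Y k - Y (nxt k)) * (X (nxt m) - X (nxt k)) = 0"
    using ez by (simp add: zx_def zy_def ex_def ey_def algebra_simps)
  note extreme[OF K(9) this]
  ultimately show False by (simp add: zx_def zy_def ex_def ey_def algebra_simps)
qed

text \<open>A point reflection moves the vertex at \<open>p\<close> to the origin, and the edge is
  traversed from its later to its earlier vertex. In these coordinates \<open>R\<close> reads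
  \<open>b * y - a * x\<close>, as required for \<open>supporting_edges\<close>.\<close>

definition edge_data :: "int \<Rightarrow> int \<times> int \<times> int \<times> int" where
  "edge_data k = (X p - X (nxt k), Y p - Y (nxt k), X (nxt k) - X k, Y (nxt k) - Y k)"

lemma inj_on_edge_data: "inj_on edge_data proper"
proof (rule inj_onI)
  fix k m assume *: "k \<in> proper" "m \<in> proper" "edge_data k = edge_data m"
  then show "k = m"
    using proper_not_parallel[of k m] proper_not_parallel[of m k]
    by (cases k m rule: linorder_cases) (auto simp: edge_data_def)
qed

text \<open>In each column the lowest lattice point on or above the line exceeds it by less than
  \<open>b\<close>, so it lies in the strip and the walk from \<open>f\<close> to \<open>p\<close>
  visits it. Higher points follow because edges never run to the left.\<close>

lemma edge_data_supports:
  assumes f: "i \<le> f" "f \<le> p"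
    and k: "k \<in> proper" and x: "0 \<le> x" "x \<le> X p - X f" "a * x \<le> b * y"
  shows "0 \<le> (X (nxt k) - X k) * (y - (Y p - Y (nxt k))) - (Y (nxt k) - Y k) * (x - (X p - X (nxt k)))"
proof -
  \<comment> \<open>The ceiling of \<open>a * x / b\<close>.\<close>
  define y0 where "y0 = - ((- (a * x)) div b)"
  have y0: "a * x \<le> b * y0" "b * (y0 - 1) < a * x"
  proof -
    have "- (a * x) = b * ((- (a * x)) div b) + (- (a * x)) mod b" by (rule mult_div_mod_eq[symmetric])
    moreover have "0 \<le> (- (a * x)) mod b" "(- (a * x)) mod b < b" using b_pos by auto
    ultimately show "a * x \<le> b * y0" "b * (y0 - 1) < a * x"
      unfolding y0_def right_diff_distrib by linarith+
  qed
  have "b * (y0 - 1) < b * y" using y0 x by linarith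
  then have y0y: "y0 \<le> y" using b_pos by simp
  have "0 \<le> a * x" using x a_pos by simp
  then have "b * (-1) < b * y0" using y0 b_pos by linarith
  then have y0_nonneg: "0 \<le> y0" unfolding mult_less_cancel_left_pos[OF b_pos] by simp
  have "R f = b * (Y p - Y f) - a * (X p - X f)" using R_p by (simp add: R_def algebra_simps)
  moreover have "0 \<le> R f" using R_bounds[of f] f bounds by simp
  moreover have "a * x \<le> a * (X p - X f)" using x a_pos by simp
  ultimately have "b * (y0 - 1) < b * (Y p - Y f)" using y0 by linarith
  then have "y0 \<le> Y p - Y f" using b_pos by simp
  then have "T f \<le> T p - (x + y0)" "T p - (x + y0) \<le> T p" using x y0_nonneg by (auto simp: T_def)
  then obtain n where n: "f \<le> n" "n \<le> p" "T n = T p - (x + y0)"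
    using intermediate[of f p "T p - (x + y0)"] f by auto
  have st: "\<mu> \<le> a * (X p - x) - b * (Y p - y0)" "a * (X p - x) - b * (Y p - y0) < \<mu> + a + b"
    using y0 upper_p a_pos by (simp_all add: algebra_simps)
  have "X n = X p - x" "Y n = Y p - y0"
    by (intro strip_point_unique; use n f st bounds in \<open>simp add: T_def\<close>)+
  then have 1: "(X (nxt k) - X k) * (Y p - y0 - Y k) - (Y (nxt k) - Y k) * (X p - x - X k) \<le> 0"
    using consecutive_edge_right[OF properD(1,2)[OF k], of n] by simp
  have "0 \<le> (X (nxt k) - X k) * (y - y0)"
    using consecutive_mono[OF properD(1)[OF k]] y0y by simp
  with 1 show ?thesis by (simp add: algebra_simps)
qed

lemma supporting_edge_data: "\<exists>N. supporting_edges a b N (edge_data ` proper)"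
proof -
  define A where "A = {k. i \<le> k \<and> k \<le> p \<and> v k}"
  \<comment> \<open>The first vertex visited is also the lowest in \<open>T\<close>, so the window
    up to its column contains all edges.\<close>
  define f where "f = Min A"
  have fA: "finite A" by (simp add: A_def)
  have "p \<in> A" using vp bounds by (simp add: A_def)
  then have "f \<in> A" unfolding f_def using fA Min_in by blast
  then have f: "i \<le> f" "f \<le> p" "v f" by (auto simp: A_def)
  have first: "f \<le> k" if "i \<le> k" "k < p" "v k" for k
    unfolding f_def by (rule Min_le) (use fA that in \<open>auto simp: A_def\<close>)
  have "finite proper" by (simp add: proper_def)
  moreover have "0 \<le> X p - X (nxt k) \<and> 0 \<le> X (nxt k) - X k \<and>
      X p - X (nxt k) + (X (nxt k) - X k) \<le> X p - X f \<and>
      a * (X p - X (nxt k)) \<le> b * (Y p - Y (nxt k)) \<and> a * (X (nxt k) - X k) < b * (Y (nxt k) - Y k)"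
    if k: "k \<in> proper" for k
  proof (intro conjI)
    note K = consecutiveD[OF properD(1)[OF k]]
    have "T (nxt k) \<le> T p" using vertex_T_mono[of "nxt k" p] K vp by simp
    then show "0 \<le> X p - X (nxt k)" using strip_mono[of "nxt k" p] K bounds by simp
    show "0 \<le> X (nxt k) - X k" using consecutive_mono[OF properD(1)[OF k]] by simp
    have "T f \<le> T k" using vertex_T_mono[of f k] first f K by simp
    then show "X p - X (nxt k) + (X (nxt k) - X k) \<le> X p - X f" using strip_mono[of f k] f K bounds by simp
    show "a * (X p - X (nxt k)) \<le> b * (Y p - Y (nxt k))"
      using R_bounds[of "nxt k"] R_p K by (simp add: R_def algebra_simps)
    show "a * (X (nxt k) - X k) < b * (Y (nxt k) - Y k)"
      using consecutive_R_less[OF properD(1,2)[OF k]] by (simp add: R_def algebra_simps)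
  qed
  moreover have "k = m" if "k \<in> proper" "m \<in> proper"
    "(X (nxt k) - X k) * (Y (nxt m) - Y m) = (Y (nxt k) - Y k) * (X (nxt m) - X m)" for k m
    using proper_not_parallel[of k m] proper_not_parallel[of m k] that
    by (cases k m rule: linorder_cases) (auto simp: mult.commute)
  ultimately have "supporting_edges a b (X p - X f) (edge_data ` proper)"
    unfolding supporting_edges_def edge_data_def using edge_data_supports[OF f(1,2)] by fastforce
  then show ?thesis by blast
qed

text \<open>An extremum of \<open>T\<close> inside a loop is a turning point, hence met only once.
  The top of a loop that starts upwards would be met again on the way to \<open>p\<close>.\<close>

lemma loop_tip:
  assumes "k \<in> loops"
  obtains m where "k < m" "m < nxt k" "T m < T k" "\<And>n. i \<le> n \<Longrightarrow> n \<le> j \<Longrightarrow> T n = T m \<Longrightarrow> n = m"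
    and "T (k + 1) = T k - 1"
proof -
  define k' where "k' = nxt k"
  note L = loopsD[OF assms, folded k'_def]
  note C = consecutiveD[OF L(1)]
  have ne: "T n \<noteq> T k" if "k < n" "n < k'" for n
    using strip_unique(3)[of n k] C that by auto
  have kk: "k + 1 < k'" using L(2) C(2) T_step[of k] by (cases "k' = k + 1") auto
  have tip: "n = m" if m: "k < m" "m < k'" "T (m - 1) = T (m + 1)" and n: "i \<le> n" "n \<le> j" "T n = T m" for m n
    by (rule turning_point) (use m n C in auto)
  have desc: "T (k + 1) < T k"
  proof (rule ccontr)
    assume "\<not> T (k + 1) < T k"
    then have up: "T k < T (k + 1)" using ne[of "k + 1"] kk by simp
    define M where "M = Max (T ` {k..k'})"
    have "M \<in> T ` {k..k'}" unfolding M_def using C by (intro Max_in) auto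
    then obtain m where m: "k \<le> m" "m \<le> k'" "T m = M" by auto
    have M_ge: "T n \<le> T m" if "k \<le> n" "n \<le> k'" for n
      unfolding m(3) M_def using that by (intro Max_ge) auto
    have Tm: "T k < T m" using M_ge[of "k + 1"] kk up by simp
    then have min: "k < m" "m < k'" using m L(2) by (auto simp: order_less_le)
    have "T (m - 1) \<le> T m" "T (m + 1) \<le> T m" using M_ge min by simp_all
    then have tm: "T (m - 1) = T (m + 1)"
      using T_step[of m] T_step[of "m - 1"] unfolding diff_add_cancel by linarith
    have "T m < T p" using below[of m] min C L(3) by simp
    then obtain n where n: "k' \<le> n" "n \<le> p" "T n = T m"
      using intermediate[of k' p "T m"] Tm L C by auto
    have "n = m" by (rule tip) (use min tm n C bounds in auto)
    then show False using n min by simp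
  qed
  define M where "M = Min (T ` {k..k'})"
  have "M \<in> T ` {k..k'}" unfolding M_def using C by (intro Min_in) auto
  then obtain m where m: "k \<le> m" "m \<le> k'" "T m = M" by auto
  have M_le: "T m \<le> T n" if "k \<le> n" "n \<le> k'" for n
    unfolding m(3) M_def using that by (intro Min_le) auto
  have Tm: "T m < T k" using M_le[of "k + 1"] kk desc by simp
  then have min: "k < m" "m < k'" using m L(2) by (auto simp: order_less_le)
  have "T m \<le> T (m - 1)" "T m \<le> T (m + 1)" using M_le min by simp_all
  then have tm: "T (m - 1) = T (m + 1)"
    using T_step[of m] T_step[of "m - 1"] unfolding diff_add_cancel by linarith
  show thesis
    by (rule that[of m]) (use min Tm tip[OF min tm] desc T_step[of k] in \<open>auto simp: k'_def\<close>)
qed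

text \<open>Suppose a vertex lies below the loop's vertex; it is visited earlier. If the loop
  reaches it, there is a vertex inside the loop; if not, the tip is met already on the way from that
  vertex to the loop.\<close>

lemma loop_first:
  assumes k: "k \<in> loops" and m: "i \<le> m" "m < p" "v m"
  shows "T k \<le> T m"
proof (rule ccontr)
  assume "\<not> T k \<le> T m"
  then have lt: "T m < T k" by simp
  note L = loopsD[OF k]
  note C = consecutiveD[OF L(1)]
  have mk: "m < k" using vertex_T_mono[of k m] lt C m by force
  obtain z where z: "k < z" "z < nxt k" "T z < T k" "\<And>n. i \<le> n \<Longrightarrow> n \<le> j \<Longrightarrow> T n = T z \<Longrightarrow> n = z"
    using loop_tip[OF k] by metis
  show False
  proof (cases "T z \<le> T m")
    case True
    then obtain n where n: "z \<le> n" "n \<le> nxt k" "T n = T m"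
      using intermediate[of z "nxt k" "T m"] lt L(2) z by auto
    then have "v n" using strip_unique(3)[of n m] m z C bounds by auto
    moreover have "n < nxt k" using n lt L(2) by (cases "n = nxt k") auto
    ultimately show False using C(10)[of n] n z by simp
  next
    case False
    then obtain n where n: "m \<le> n" "n \<le> k" "T n = T z"
      using intermediate[of m k "T z"] mk z by auto
    then have "n = z" using z(4)[of n] m C by simp
    then show False using n z by simp
  qed
qed

text \<open>By \<open>loop_first\<close> both loops sit at the same point, and the one that reaches
  farther down meets the tip of the other.\<close>

lemma loops_unique:
  assumes k: "k \<in> loops" and m: "m \<in> loops" and "k < m"
  shows False
proof -
  note K = loopsD[OF k] and M = loopsD[OF m]
  note CK = consecutiveD[OF K(1)] and CM = consecutiveD[OF M(1)]
  have km: "nxt k \<le> m" using nxt(2)[of k m] CK CM \<open>k < m\<close> by auto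
  have T: "T k = T m" using loop_first[OF k, of m] loop_first[OF m, of k] CK CM by simp
  obtain z where z: "k < z" "z < nxt k" "T z < T k" "\<And>n. i \<le> n \<Longrightarrow> n \<le> j \<Longrightarrow> T n = T z \<Longrightarrow> n = z"
    using loop_tip[OF k] by metis
  obtain w where w: "m < w" "w < nxt m" "T w < T m" "\<And>n. i \<le> n \<Longrightarrow> n \<le> j \<Longrightarrow> T n = T w \<Longrightarrow> n = w"
    using loop_tip[OF m] by metis
  show False
  proof (cases "T z \<le> T w")
    case True
    then obtain n where n: "z \<le> n" "n \<le> nxt k" "T n = T w"
      using intermediate[of z "nxt k" "T w"] w z K(2) T by auto
    then have "n = w" using w(4)[of n] z CK by simp
    then show False using n w km by simp
  next
    case False
    then obtain n where n: "m \<le> n" "n \<le> w" "T n = T z"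
      using intermediate[of m w "T z"] w z T by auto
    then have "n = z" using z(4)[of n] w CM by simp
    then show False using n z km by simp
  qed
qed

text \<open>A loop starts by entering the strip point just before its vertex. That point cannot be
  the left neighbour, which lies to the left of the edge leaving the vertex, so it is the
  lower one, and the vertex has small remainder.\<close>

lemma loop_vertex:
  assumes k: "k \<in> loops"
  shows "X (k + 1) = X k" "Y (k + 1) = Y k - 1" "R k < a"
proof -
  note L = loopsD[OF k]
  note C = consecutiveD[OF L(1)]
  define A where "A = {n. i \<le> n \<and> n < p \<and> v n \<and> T n = T k}"
  \<comment> \<open>From the last visit to the loop's vertex a proper edge leaves.\<close>
  define s where "s = Max A"
  have fA: "finite A" by (simp add: A_def)
  have "k \<in> A" using C by (simp add: A_def)
  then have "s \<in> A" unfolding s_def using fA Max_in by blast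
  then have s: "i \<le> s" "s < p" "v s" "T s = T k" by (auto simp: A_def)
  have "s \<in> proper"
  proof (rule ccontr)
    assume "s \<notin> proper"
    then have sl: "s \<in> loops" using s by (auto simp: proper_def loops_def)
    note S = loopsD[OF sl]
    have "nxt s \<in> A" using S consecutiveD[OF S(1)] s by (simp add: A_def)
    then have "nxt s \<le> s" unfolding s_def using fA by simp
    then show False using consecutiveD(2)[OF S(1)] by simp
  qed
  note P = properD[OF this]
  have sk: "X s = X k" "Y s = Y k" using strip_unique(1,2)[of s k] s C bounds by auto
  have "a * (X (nxt s) - X s) < b * (Y (nxt s) - Y s)"
    using consecutive_R_less[OF P(1,2)] by (simp add: R_def algebra_simps)
  moreover have "0 \<le> a * (X (nxt s) - X s)" using consecutive_mono[OF P(1)] a_pos by simp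
  ultimately have ey: "0 < Y (nxt s) - Y s" using b_pos by (smt (verit) mult_nonneg_nonpos)
  obtain m where d: "T (k + 1) = T k - 1" using loop_tip[OF k] by metis
  have not_left: "\<not> (X (k + 1) = X k - 1 \<and> Y (k + 1) = Y k)"
    using consecutive_edge_right[OF P(1,2), of "k + 1"] ey sk by auto
  show xy: "X (k + 1) = X k" "Y (k + 1) = Y k - 1"
    using adj[of k] d not_left unfolding T_def by linarith+
  \<comment> \<open>The step down raises the remainder by \<open>b\<close>, which leaves less than
    \<open>a\<close> for the vertex.\<close>
  have "R (k + 1) < a + b" using R_bounds[of "k + 1"] C by simp
  then show "R k < a" unfolding R_def xy by (simp add: algebra_simps)
qed

lemma card_vertices_before_p:
  assumes "a \<noteq> b"
  shows "card {k. i \<le> k \<and> k < p \<and> v k} \<le> cf_depth (nat (min a b)) (nat (max a b))"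
proof -
  have fin: "finite proper" "finite loops" by (simp_all add: proper_def loops_def)
  have "{k. i \<le> k \<and> k < p \<and> v k} = proper \<union> loops" by (auto simp: proper_def loops_def)
  then have card_eq: "card {k. i \<le> k \<and> k < p \<and> v k} = card (edge_data ` proper) + card loops"
    using fin by (subst card_image[OF inj_on_edge_data])
      (simp, rule card_Un_disjoint, auto simp: proper_def loops_def)
  have "card loops \<le> 1"
    unfolding One_nat_def card_le_Suc0_iff_eq[OF fin(2)] using loops_unique by (metis linorder_cases)
  obtain N where N: "supporting_edges a b N (edge_data ` proper)" using supporting_edge_data by blast
  have rem: "b * (py + ey) - a * (px + ex) = R k"
    if "k \<in> proper" "edge_data k = (px, py, ex, ey)" for px py ex ey k
    using that R_p by (auto simp: edge_data_def R_def algebra_simps)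
  have R_lt: "R k < a + b" if "k \<in> proper" for k
    using R_bounds[of k] that bounds by (auto simp: proper_def)
  show ?thesis
  proof (cases "loops = {}")
    case True
    show ?thesis
    proof (cases "a < b")
      case ab: True
      have "card (edge_data ` proper) \<le> cf_depth (nat a) (nat b)"
        by (rule card_le_cf_depth(1)[OF a_pos ab N]) (use rem R_lt in fastforce)
      then show ?thesis using card_eq True ab by simp
    next
      case False
      then have ba: "b < a" using assms by simp
      then show ?thesis using card_le_cf_depth_swap(1)[OF b_pos ba N] card_eq True by simp
    qed
  next
    case False
    then obtain l where l: "l \<in> loops" by blast
    note C = consecutiveD[OF loopsD(1)[OF l]]
    have "card (edge_data ` proper) + 1 \<le> cf_depth (nat (min a b)) (nat (max a b))"
    proof (cases "a < b")
      case ab: True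
      \<comment> \<open>The loop sits at the lowest vertex of the chain, which has the largest
        remainder.\<close>
      have "R k < a" if k: "k \<in> proper" for k
      proof (cases "l \<le> k")
        case True
        then have "R k \<le> R l" using vertex_R_mono[of l k] C k by (auto simp: proper_def)
        then show ?thesis using loop_vertex(3)[OF l] by simp
      next
        case False
        then have "T k \<le> T l" using vertex_T_mono[of k l] C k by (auto simp: proper_def)
        moreover have "T l \<le> T k" using loop_first[OF l, of k] k by (auto simp: proper_def)
        ultimately have "R k = R l" using strip_unique(4)[of k l] C k bounds by (auto simp: proper_def)
        then show ?thesis using loop_vertex(3)[OF l] by simp
      qed
      then have "card (edge_data ` proper) + 1 \<le> cf_depth (nat a) (nat b)"
        by (intro card_le_cf_depth(2)[OF a_pos ab N]) (use rem in fastforce)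
      then show ?thesis using ab by simp
    next
      case False
      then have ba: "b < a" using assms by simp
      \<comment> \<open>The support condition puts the loop's vertex on the column of a vertical
        edge. The loop's first point, one below, and the upper end of the edge would then enclose
        the lower end.\<close>
      have "X k < X (nxt k)" if k: "k \<in> proper" for k
      proof (rule ccontr)
        assume "\<not> X k < X (nxt k)"
        note P = properD[OF k]
        note K = consecutiveD[OF P(1)]
        have vert: "X (nxt k) = X k" using consecutive_mono(1)[OF P(1)] \<open>\<not> X k < X (nxt k)\<close> by simp
        have up: "Y k < Y (nxt k)" using P(3) vert by (simp add: T_def)
        have "T l \<le> T k" using loop_first[OF l, of k] K by simp
        then have lk: "X l \<le> X k" "Y l \<le> Y k" using strip_mono[of l k] C K by auto
        have "0 \<le> (Y (nxt k) - Y k) * (X l - X k)"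
          using consecutive_edge_right[OF P(1,2), of l] vert by simp
        then have "X l = X k" using up lk by (simp add: zero_le_mult_iff)
        then have "0 \<le> (Y l - 1 - Y k) * (Y (nxt k) - Y k)"
          using extreme[OF K(8), of "l + 1" "nxt k"] vert loop_vertex(1,2)[OF l] by simp
        then show False using up lk by (simp add: zero_le_mult_iff)
      qed
      then have "card (edge_data ` proper) + 1 \<le> cf_depth (nat b) (nat a)"
        by (intro card_le_cf_depth_swap(2)[OF b_pos ba N]) (auto simp: edge_data_def)
      then show ?thesis using ba by simp
    qed
    then show ?thesis using card_eq \<open>card loops \<le> 1\<close> by simp
  qed
qed

end

lemma (in strip_walk) card_vertices_le_cf_depth:
  assumes "a \<noteq> b"
  shows "card {k. i \<le> k \<and> k < p \<and> v k} \<le> cf_depth (nat (min a b)) (nat (max a b))"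
proof (cases "\<exists>k. i \<le> k \<and> k < p \<and> T p < T k")
  case True
  then have "{k. i \<le> k \<and> k < p \<and> v k} = {}" using no_vertex_if_above by blast
  then show ?thesis by (metis card.empty le0)
next
  case False
  then have "T k < T p" if "i \<le> k" "k < p" for k
    using T_ne_p that by (metis linorder_cases)
  then interpret forward_strip_walk X Y v i j p q a b \<mu>
    by unfold_locales
  show ?thesis by (rule card_vertices_before_p[OF assms])
qed

section \<open>Contours\<close>

lemma periodic_mult:
  fixes c :: "int \<Rightarrow> 'a"
  assumes "\<And>k. c (k + L) = c k"
  shows "c (k + L * n) = c k"
proof (induction n rule: int_induct[where k = 0])
  case base
  show ?case by simp
next
  case (step1 n)
  then show ?case using assms[of "k + L * n"] by (simp add: algebra_simps)
next
  case (step2 n)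
  then show ?case using assms[of "k + L * (n - 1)"] by (simp add: algebra_simps)
qed

lemma periodic_range:
  fixes c :: "int \<Rightarrow> 'a"
  assumes "\<And>k. c (k + L) = c k" "0 < L"
  shows "c ` {0..<L} = range c"
proof -
  have "c k \<in> c ` {0..<L}" for k
    using periodic_mult[of c L "k mod L" "k div L"] assms
    by (intro image_eqI[of _ _ "k mod L"]) (simp_all add: ac_simps)
  then show ?thesis by auto
qed

lemma contour_in_polygon:
  assumes "contour_curve G V c L"
  shows "c k \<in> G"
  using assms periodic_range[of c L] unfolding contour_curve_def boundary_pts_def by blast

lemma int_strict_mono:
  fixes f :: "int \<Rightarrow> int"
  assumes "\<And>k. f k < f (k + 1)" "k < k'"
  shows "f k < f k'"
  using assms(2)
proof (induction k' rule: int_gr_induct)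
  case base
  show ?case by (rule assms(1))
next
  case (step n)
  then show ?case using assms(1)[of n] by simp
qed

section \<open>Shortening a contour at a turning point\<close>

text \<open>The shorter contour omits the times \<open>m\<close> and \<open>m + 1\<close>.\<close>

lemma contour_curve_shorten:
  assumes cc: "contour_curve G V c L" and turn: "c (m - 1) = c (m + 1)" and nv: "c m \<notin> V"
    and again: "c m' = c m" "\<not> L dvd m' - m"
  shows "\<exists>c'. contour_curve G V c' (L - 2)"
proof -
  have per: "\<And>k. c (k + L) = c k" and adj: "\<And>k. adj4 (c k) (c (k + 1))" and L0: "0 < L"
    and img: "c ` {0..<L} = boundary_pts G"
    and right: "\<And>k k' z. k < k' \<Longrightarrow> k' \<le> k + L \<Longrightarrow> c k \<in> V \<Longrightarrow> c k' \<in> V \<Longrightarrow>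
        (\<And>m. k < m \<Longrightarrow> m < k' \<Longrightarrow> c m \<notin> V) \<Longrightarrow> c k \<noteq> c k' \<Longrightarrow> z \<in> G \<Longrightarrow>
        cross (vsub (c k') (c k)) (vsub z (c k)) \<le> 0"
    using cc unfolding contour_curve_def by blast+
  have perm: "c (k + L * n) = c k" for k n using per by (rule periodic_mult)
  have neq: "c k \<noteq> c (k + 1)" for k using adj[of k] by (auto simp: adj4_def)
  \<comment> \<open>The new period \<open>L - 2\<close> must be positive. For \<open>L = 2\<close>
    the time \<open>m'\<close> would show the point \<open>c (m + 1)\<close>, which differs from
    \<open>c m\<close>.\<close>
  have L3: "3 \<le> L"
  proof (rule ccontr)
    assume "\<not> 3 \<le> L"
    moreover have "L \<noteq> 1" using again(2) by auto
    ultimately have L2: "L = 2" using L0 by simp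
    then have "odd (m' - m)" using again(2) by simp
    then obtain n where "m' - m = 2 * n + 1" by (elim oddE)
    then have "m' = m + 1 + L * n" using L2 by simp
    then have "c m' = c (m + 1)" using perm by simp
    then show False using neq[of m] again(1) by simp
  qed
  define P where "P = L - 2"
  \<comment> \<open>\<open>\<phi>\<close> enumerates in increasing order the times not congruent to
    \<open>m\<close> or \<open>m + 1\<close> modulo \<open>L\<close>.\<close>
  define \<phi> where "\<phi> k = m + 2 + k mod P + L * (k div P)" for k
  have P: "0 < P" "L = P + 2" using L3 by (auto simp: P_def)
  have phi_eq: "\<phi> (e + P * d) = m + 2 + e + L * d" if "0 \<le> e" "e < P" for e d
    using that by (simp add: \<phi>_def)
  have dec: "k = k mod P + P * (k div P)" "0 \<le> k mod P" "k mod P < P" for k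
    using P by simp_all
  have phi_suc: "\<phi> (k + 1) = (if k mod P = P - 1 then \<phi> k + 3 else \<phi> k + 1)" for k
  proof (cases "k mod P = P - 1")
    case True
    have "k + 1 = k mod P + 1 + P * (k div P)" using dec(1)[of k] by linarith
    then have "k + 1 = 0 + P * (k div P + 1)" using True by (simp add: algebra_simps)
    then have "\<phi> (k + 1) = \<phi> (0 + P * (k div P + 1))" by (rule arg_cong)
    also have "\<dots> = m + 2 + 0 + L * (k div P + 1)" by (rule phi_eq) (use P in auto)
    finally have "\<phi> (k + 1) = m + 2 + 0 + L * (k div P + 1)" .
    moreover have "\<phi> k = m + 2 + (P - 1) + L * (k div P)" unfolding \<phi>_def using True by simp
    moreover have "L * (k div P + 1) = L * (k div P) + L" by (simp add: algebra_simps)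
    ultimately show ?thesis using True P(2) by simp
  next
    case False
    have "k + 1 = (k mod P + 1) + P * (k div P)" using dec(1)[of k] by linarith
    then have "\<phi> (k + 1) = m + 2 + (k mod P + 1) + L * (k div P)"
      using phi_eq[of "k mod P + 1" "k div P"] dec(2,3)[of k] False by simp
    then show ?thesis using False by (simp add: \<phi>_def)
  qed
  have phi_mono: "\<phi> k < \<phi> k'" if "k < k'" for k k'
    by (rule int_strict_mono[OF _ that]) (simp add: phi_suc)
  have phi_less: "\<phi> k < \<phi> k' \<Longrightarrow> k < k'" for k k'
    using phi_mono by (metis less_asym' linorder_cases order_less_irrefl)
  have phi_per: "\<phi> (k + P) = \<phi> k + L" for k
    using P by (simp add: \<phi>_def algebra_simps)
  have last: "\<phi> k = m - 1 + L * (k div P + 1)" if "k mod P = P - 1" for k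
  proof -
    have "\<phi> k = m + 2 + (P - 1) + L * (k div P)" unfolding \<phi>_def using that by simp
    then show ?thesis using P(2) by (simp add: distrib_left)
  qed
  have turn': "c (m - 1 + L * d) = c (m + 1 + L * d)" for d
    using perm turn by simp
  \<comment> \<open>No point is lost: \<open>m'\<close> replaces the times congruent to
    \<open>m\<close>, and the times congruent to \<open>m - 1\<close> replace those congruent to
    \<open>m + 1\<close>.\<close>
  have hit: "\<exists>k. c n = c (\<phi> k)" for n
  proof -
    have main: "\<exists>k. c n = c (\<phi> k)" if "\<not> L dvd n - m" for n
    proof -
      define e d where "e = (n - m) mod L" and "d = (n - m) div L"
      have n: "n = m + e + L * d" unfolding e_def d_def by (simp add: algebra_simps)
      have e: "0 < e" "e < L" 
        using that pos_mod_sign[OF L0, of "n - m"] pos_mod_bound[OF L0, of "n - m"]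
        unfolding e_def dvd_eq_mod_eq_0 by linarith+
      show ?thesis
      proof (cases "e = 1")
        case True
        then have "c n = c (m - 1 + L * d)" using n turn' by simp
        also have "m - 1 + L * d = \<phi> (P - 1 + P * (d - 1))"
          using phi_eq[of "P - 1" "d - 1"] P by (simp add: algebra_simps)
        finally show ?thesis by blast
      next
        case False
        then have "n = \<phi> (e - 2 + P * d)" using phi_eq[of "e - 2" d] e P n by simp
        then show ?thesis by blast
      qed
    qed
    show ?thesis
    proof (cases "L dvd n - m")
      case True
      then obtain d where "n = m + L * d" by (metis add.commute diff_add_cancel dvdE)
      then have "c n = c m'" using perm again(1) by simp
      then show ?thesis using main[OF again(2)] by simp
    next
      case False
      then show ?thesis by (rule main)
    qed
  qed
  have "contour_curve G V (\<lambda>k. c (\<phi> k)) P"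
    unfolding contour_curve_def
  proof (intro conjI allI impI)
    show "0 < P" by (rule P)
    show per': "c (\<phi> (k + P)) = c (\<phi> k)" for k by (simp add: phi_per per)
    show "adj4 (c (\<phi> k)) (c (\<phi> (k + 1)))" for k
    proof (cases "k mod P = P - 1")
      case True
      define d where "d = k div P + 1"
      have e1: "c (\<phi> k) = c (m + 1 + L * d)" using last[OF True] turn' by (simp add: d_def)
      have e2: "\<phi> (k + 1) = m + 1 + L * d + 1" using last[OF True] phi_suc[of k] True by (simp add: d_def)
      show ?thesis unfolding e1 e2 by (rule adj)
    next
      case False
      then show ?thesis using adj[of "\<phi> k"] phi_suc[of k] by simp
    qed
    have "(\<lambda>k. c (\<phi> k)) ` {0..<P} = range (\<lambda>k. c (\<phi> k))"
      by (rule periodic_range) (use per' P in auto)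
    also have "\<dots> = range c" using hit by (auto simp: image_iff)
    also have "\<dots> = c ` {0..<L}" by (rule periodic_range[symmetric]) (use per L0 in auto)
    finally show "(\<lambda>k. c (\<phi> k)) ` {0..<P} = boundary_pts G" using img by simp
  next
    fix k k'
    assume H: "k < k' \<and> k' \<le> k + P \<and> c (\<phi> k) \<in> V \<and> c (\<phi> k') \<in> V \<and>
      (\<forall>m. k < m \<and> m < k' \<longrightarrow> c (\<phi> m) \<notin> V) \<and> c (\<phi> k) \<noteq> c (\<phi> k')"
    \<comment> \<open>An edge starting just before the gap is read as starting at the equal point
      two steps later; otherwise the old contour would visit a vertex in between.\<close>
    define s where "s = (if k mod P = P - 1 then \<phi> k + 2 else \<phi> k)"
    have cs: "c s = c (\<phi> k)"
    proof (cases "k mod P = P - 1")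
      case True
      then have "s = m + 1 + L * (k div P + 1)" using last[OF True] by (simp add: s_def)
      then show ?thesis using turn'[of "k div P + 1"] last[OF True] by metis
    qed (simp add: s_def)
    have sk: "\<phi> k \<le> s" by (simp add: s_def)
    have "s < \<phi> (k + 1)" by (simp add: s_def phi_suc)
    also have "\<phi> (k + 1) \<le> \<phi> k'" using H phi_mono[of "k + 1" k'] by (cases "k + 1 = k'") auto
    finally have ss: "s < \<phi> k'" .
    have "\<phi> k' \<le> \<phi> k + L"
      using H phi_mono[of k' "k + P"] phi_per[of k] by (cases "k' = k + P") auto
    then have sL: "\<phi> k' \<le> s + L" using sk by simp
    have inner: "c t \<notin> V" if t: "s < t" "t < \<phi> k'" for t
    proof -
      define e d where "e = (t - m) mod L" and "d = (t - m) div L"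
      have te: "t = m + e + L * d" unfolding e_def d_def by (simp add: algebra_simps)
      have e: "0 \<le> e" "e < L" using L0 by (auto simp: e_def)
      consider "e = 0" | "e = 1" | "2 \<le> e" using e by linarith
      then show ?thesis
      proof cases
        case 1
        then show ?thesis using te perm nv by simp
      next
        case 2
        \<comment> \<open>The omitted time \<open>t\<close> shows the same point as the kept time
          \<open>t - 2\<close>, whose index \<open>\<kappa>\<close> lies strictly between
          \<open>k\<close> and \<open>k'\<close>.\<close>
        define \<kappa> where "\<kappa> = P - 1 + P * (d - 1)"
        have k1: "\<phi> \<kappa> = t - 2"
          using phi_eq[of "P - 1" "d - 1"] P te 2 by (simp add: \<kappa>_def algebra_simps)
        have "\<kappa> + 1 = 0 + P * d" by (simp add: \<kappa>_def algebra_simps)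
        then have k2: "\<phi> (\<kappa> + 1) = t + 1" using phi_eq[of 0 d] P te 2 by simp
        have "\<phi> k < t + 1" using sk t by simp
        then have "k < \<kappa> + 1" using phi_less[of k "\<kappa> + 1"] k2 by simp
        moreover have "k \<noteq> \<kappa>"
        proof
          assume "k = \<kappa>"
          moreover have "\<kappa> mod P = P - 1"
            unfolding \<kappa>_def mod_mult_self2 using P by (intro mod_pos_pos_trivial) auto
          ultimately have "s = t" using k1 by (simp add: s_def)
          then show False using t by simp
        qed
        ultimately have "k < \<kappa>" by simp
        moreover have "\<kappa> < k'" using phi_less[of \<kappa> k'] k1 t by simp
        ultimately have "c (t - 2) \<notin> V" using H k1 by metis
        moreover have "t = m + 1 + L * d" "t - 2 = m - 1 + L * d" using te 2 by simp_all
        then have "c (t - 2) = c t" using turn'[of d] by metis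
        ultimately show ?thesis by simp
      next
        case 3
        then have tphi: "t = \<phi> (e - 2 + P * d)" using phi_eq[of "e - 2" d] e P te by simp
        then have "k < e - 2 + P * d" "e - 2 + P * d < k'"
          using phi_less[of k "e - 2 + P * d"] phi_less[of "e - 2 + P * d" k'] t sk by auto
        then show ?thesis using H tphi by blast
      qed
    qed
    show "\<forall>z\<in>G. cross (vsub (c (\<phi> k')) (c (\<phi> k))) (vsub z (c (\<phi> k))) \<le> 0"
      using right[OF ss sL _ _ inner] H cs by metis
  qed
  then show ?thesis unfolding P_def by blast
qed

lemma contour_turning_point:
  assumes "is_contour G V c L" "c (m - 1) = c (m + 1)" "c m \<notin> V" "c m' = c m"
  shows "L dvd m' - m"
proof (rule ccontr)
  assume "\<not> L dvd m' - m"
  then obtain c' where "contour_curve G V c' (L - 2)"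
    using contour_curve_shorten[of G V c L m m'] assms unfolding is_contour_def by blast
  then show False using assms(1) unfolding is_contour_def by force
qed

section \<open>Vertices as extreme points\<close>

lemma vertex_extreme:
  assumes fin: "finite G" and vs: "is_vertex_set G V" and w: "w \<in> V"
  shows "toR w extreme_point_of (convex hull (toR ` V))"
proof -
  have V: "V \<subseteq> G" "digitize (convex hull (toR ` V)) = G"
    "\<And>W. W \<subset> V \<Longrightarrow> digitize (convex hull (toR ` W)) \<noteq> G"
    using vs unfolding is_vertex_set_def by blast+
  have fV: "finite V" using V(1) fin by (rule finite_subset)
  have ins: "toR ` V = insert (toR w) (toR ` (V - {w}))" using w by auto
  \<comment> \<open>Otherwise dropping \<open>w\<close> would not change the hull, against the
    minimality of \<open>V\<close>.\<close>
  have "toR w \<notin> convex hull (toR ` (V - {w}))"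
  proof
    assume "toR w \<in> convex hull (toR ` (V - {w}))"
    then have "convex hull (toR ` V) = convex hull (toR ` (V - {w}))"
      unfolding ins by (rule hull_redundant)
    moreover have "V - {w} \<subset> V" using w by blast
    ultimately show False using V by metis
  qed
  then show ?thesis unfolding ins using fV by (intro extreme_point_of_convex_hull_insert) auto
qed

lemma vertex_not_between:
  assumes fin: "finite G" and vs: "is_vertex_set G V" and w: "w \<in> V" and P: "P \<in> G" and Q: "Q \<in> G"
    and cr: "(fst P - fst w) * (snd Q - snd w) - (snd P - snd w) * (fst Q - fst w) = 0"
  shows "0 \<le> (fst P - fst w) * (fst Q - fst w) + (snd P - snd w) * (snd Q - snd w)"
proof (rule ccontr)
  define ax ay bx "by" :: real where "ax = real_of_int (fst P - fst w)" and "ay = real_of_int (snd P - snd w)"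
    and "bx = real_of_int (fst Q - fst w)" and "by = real_of_int (snd Q - snd w)"
  note defs = ax_def ay_def bx_def by_def
  assume "\<not> 0 \<le> (fst P - fst w) * (fst Q - fst w) + (snd P - snd w) * (snd Q - snd w)"
  then have "(fst P - fst w) * (fst Q - fst w) + (snd P - snd w) * (snd Q - snd w) < 0" by simp
  then have "real_of_int ((fst P - fst w) * (fst Q - fst w) + (snd P - snd w) * (snd Q - snd w)) < 0"
    by (simp only: of_int_less_0_iff)
  then have dot: "ax * bx + ay * by < 0" by (simp add: defs)
  have "real_of_int ((fst P - fst w) * (snd Q - snd w) - (snd P - snd w) * (fst Q - fst w)) = 0"
    using cr by (simp only: of_int_0)
  then have c0: "ax * by = ay * bx" by (simp add: defs)
  \<comment> \<open>For the vectors from \<open>w\<close> to \<open>P\<close> and \<open>Q\<close>,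
    collinearity makes the combination with weights \<open>\<beta>\<close> and
    \<open>\<alpha>\<close> vanish. Both weights are positive, so \<open>w\<close> lies inside the
    open segment.\<close>
  define \<alpha> \<beta> where "\<alpha> = - (ax * bx + ay * by)" and "\<beta> = bx * bx + by * by"
  have \<alpha>: "0 < \<alpha>" using dot by (simp add: \<alpha>_def)
  have "bx \<noteq> 0 \<or> by \<noteq> 0" using dot by auto
  then have \<beta>: "0 < \<beta>" unfolding \<beta>_def using not_sum_squares_lt_zero
    by (metis sum_squares_gt_zero_iff)
  define u where "u = \<alpha> / (\<alpha> + \<beta>)"
  have u: "0 < u" "u < 1" "1 - u = \<beta> / (\<alpha> + \<beta>)"
    using \<alpha> \<beta> by (auto simp: u_def field_simps)
  have comb: "\<beta> * ax + \<alpha> * bx = 0" "\<beta> * ay + \<alpha> * by = 0"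
    unfolding \<alpha>_def \<beta>_def using c0 by algebra+
  have zero: "(1 - u) * ax + u * bx = 0" "(1 - u) * ay + u * by = 0"
    using comb u(3) \<alpha> \<beta> by (simp_all add: u_def add_divide_distrib[symmetric])
  have fx: "real_of_int (fst P) = real_of_int (fst w) + ax" "real_of_int (snd P) = real_of_int (snd w) + ay"
    "real_of_int (fst Q) = real_of_int (fst w) + bx" "real_of_int (snd Q) = real_of_int (snd w) + by"
    by (simp_all add: defs)
  have "toR w = (1 - u) *\<^sub>R toR P + u *\<^sub>R toR Q"
    using zero by (simp add: toR_def fx algebra_simps)
  moreover have "toR P \<noteq> toR Q"
  proof
    assume "toR P = toR Q"
    then have "ax = bx" "ay = by" by (auto simp: toR_def defs)
    then have "0 \<le> ax * bx + ay * by" by simp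
    then show False using dot by simp
  qed
  ultimately have "toR w \<in> open_segment (toR P) (toR Q)"
    using u unfolding in_segment by blast
  moreover have "toR P \<in> convex hull (toR ` V)" "toR Q \<in> convex hull (toR ` V)"
    using P Q vs unfolding is_vertex_set_def digitize_def by blast+
  ultimately show False
    using vertex_extreme[OF fin vs w] unfolding extreme_point_of_def by blast
qed

section \<open>From the contour to a walk in a strip\<close>

text \<open>The hypotheses on \<open>m11, m12, m21, m22\<close> and \<open>d\<close> describe a symmetry of the square lattice with
  determinant \<open>d\<close>; the reflections go with a reversal of time, so that the polygon stays on the right.\<close>

lemma contour_strip_walk:
  fixes m11 m12 m21 m22 d :: int
  assumes cdp: "is_cdp G" and vert: "is_vertex_set G V" and cont: "is_contour G V c L"
    and M: "m11 * m11 + m21 * m21 = 1" "m12 * m12 + m22 * m22 = 1" "m11 * m12 + m21 * m22 = 0"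
      "m11 * m22 - m12 * m21 = d" "\<bar>m11\<bar> + \<bar>m21\<bar> = 1" "\<bar>m12\<bar> + \<bar>m22\<bar> = 1"
    and d: "d = 1 \<or> d = -1"
    and X: "\<And>k. X k = m11 * fst (c (d * k)) + m12 * snd (c (d * k))"
    and Y: "\<And>k. Y k = m21 * fst (c (d * k)) + m22 * snd (c (d * k))"
    and len: "j - i < L" and pos: "0 < a" "0 < b"
    and strip: "\<And>k. i \<le> k \<Longrightarrow> k \<le> j \<Longrightarrow> \<mu> \<le> a * X k - b * Y k \<and> a * X k - b * Y k < \<mu> + a + b"
    and pq: "i \<le> p" "p < q" "q \<le> j" "c (d * p) \<in> V" "c (d * q) \<in> V"
      "\<And>k. p < k \<Longrightarrow> k < q \<Longrightarrow> c (d * k) \<notin> V"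
    and upper: "a * X p - b * Y p = \<mu>" "a * X q - b * Y q = \<mu>"
      "\<And>k. i \<le> k \<Longrightarrow> k < p \<Longrightarrow> a * X k - b * Y k \<noteq> \<mu>"
  shows "strip_walk X Y (\<lambda>k. c (d * k) \<in> V) i j p q a b \<mu>"
proof -
  define x y where "x k = fst (c k)" and "y k = snd (c k)" for k
  have XY: "X k = m11 * x (d * k) + m12 * y (d * k)" "Y k = m21 * x (d * k) + m22 * y (d * k)" for k
    by (simp_all add: X Y x_def y_def)
  have cc: "contour_curve G V c L" using cont by (simp add: is_contour_def)
  have inG: "c k \<in> G" for k using cc by (rule contour_in_polygon)
  have finG: "finite G" using cdp by (simp add: is_cdp_def)
  have adj: "\<bar>x k - x (k + 1)\<bar> + \<bar>y k - y (k + 1)\<bar> = 1" for k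
    using cc by (simp add: contour_curve_def adj4_def x_def y_def)
  have right: "(x k' - x k) * (y m - y k) - (y k' - y k) * (x m - x k) \<le> 0"
    if "k < k'" "k' \<le> k + L" "c k \<in> V" "c k' \<in> V" "\<And>m. k < m \<Longrightarrow> m < k' \<Longrightarrow> c m \<notin> V" "c k \<noteq> c k'" for k k' m
  proof -
    have "\<forall>k k'. k < k' \<and> k' \<le> k + L \<and> c k \<in> V \<and> c k' \<in> V \<and>
        (\<forall>m. k < m \<and> m < k' \<longrightarrow> c m \<notin> V) \<and> c k \<noteq> c k' \<longrightarrow>
        (\<forall>z\<in>G. cross (vsub (c k') (c k)) (vsub z (c k)) \<le> 0)"
      using cc unfolding contour_curve_def by (elim conjE)
    then have "\<forall>z\<in>G. cross (vsub (c k') (c k)) (vsub z (c k)) \<le> 0"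
      using that by simp
    from bspec[OF this inG[of m]] show ?thesis by (simp add: cross_def vsub_def x_def y_def)
  qed
  \<comment> \<open>The transpose inverts the orthogonal matrix.\<close>
  have back_x: "x (d * k) = m11 * X k + m21 * Y k" for k
  proof -
    have "m11 * X k + m21 * Y k =
        (m11 * m11 + m21 * m21) * x (d * k) + (m11 * m12 + m21 * m22) * y (d * k)"
      unfolding XY by (simp add: algebra_simps)
    then show ?thesis using M by simp
  qed
  have back_y: "y (d * k) = m12 * X k + m22 * Y k" for k
  proof -
    have "m12 * X k + m22 * Y k =
        (m11 * m12 + m21 * m22) * x (d * k) + (m12 * m12 + m22 * m22) * y (d * k)"
      unfolding XY by (simp add: algebra_simps)
    then show ?thesis using M by simp
  qed
  have same: "c (d * k) = c (d * m)" if "X k = X m" "Y k = Y m" for k m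
    using back_x[of k] back_x[of m] back_y[of k] back_y[of m] that
    by (simp add: prod_eq_iff x_def y_def)
  have det: "(X k' - X k) * (Y m - Y k) - (Y k' - Y k) * (X m - X k) =
      d * ((x (d * k') - x (d * k)) * (y (d * m) - y (d * k)) - (y (d * k') - y (d * k)) * (x (d * m) - x (d * k)))"
    for k k' m
    unfolding XY M(4)[symmetric] by (simp add: algebra_simps)
  have dot: "(X m - X k) * (X m' - X k) + (Y m - Y k) * (Y m' - Y k) =
      (x (d * m) - x (d * k)) * (x (d * m') - x (d * k)) + (y (d * m) - y (d * k)) * (y (d * m') - y (d * k))"
    for k m m'
  proof -
    define ux uy vx vy where "ux = x (d * m) - x (d * k)" and "uy = y (d * m) - y (d * k)"
      and "vx = x (d * m') - x (d * k)" and "vy = y (d * m') - y (d * k)"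
    have "(X m - X k) * (X m' - X k) + (Y m - Y k) * (Y m' - Y k) =
        (m11 * ux + m12 * uy) * (m11 * vx + m12 * vy) + (m21 * ux + m22 * uy) * (m21 * vx + m22 * vy)"
      unfolding XY ux_def uy_def vx_def vy_def by (simp add: algebra_simps)
    also have "\<dots> = (m11 * m11 + m21 * m21) * (ux * vx) + (m12 * m12 + m22 * m22) * (uy * vy) +
        (m11 * m12 + m21 * m22) * (ux * vy + uy * vx)"
      by (simp add: algebra_simps)
    also have "\<dots> = ux * vx + uy * vy" using M by simp
    finally show ?thesis by (simp add: ux_def uy_def vx_def vy_def)
  qed
  show ?thesis
  proof
    show "0 < a" "0 < b" by (fact pos)+
    show "i \<le> p" "p < q" "q \<le> j" "c (d * p) \<in> V" "c (d * q) \<in> V" by (fact pq)+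
    show "\<And>m. p < m \<Longrightarrow> m < q \<Longrightarrow> c (d * m) \<notin> V" by (fact pq(6))
    show "a * X p - b * Y p = \<mu>" "a * X q - b * Y q = \<mu>" by (fact upper)+
    show "\<And>k. i \<le> k \<Longrightarrow> k < p \<Longrightarrow> a * X k - b * Y k \<noteq> \<mu>" by (fact upper(3))
    show "\<And>k. i \<le> k \<Longrightarrow> k \<le> j \<Longrightarrow> \<mu> \<le> a * X k - b * Y k \<and> a * X k - b * Y k < \<mu> + a + b" by (fact strip)
    show "(c (d * k) \<in> V) = (c (d * m) \<in> V)" if "X k = X m" "Y k = Y m" for k m
      using same[OF that] by simp
    show "\<bar>X k - X (k + 1)\<bar> + \<bar>Y k - Y (k + 1)\<bar> = 1" for k
    proof -
      define ux uy where "ux = x (d * k) - x (d * (k + 1))" and "uy = y (d * k) - y (d * (k + 1))"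
      have "\<bar>ux\<bar> + \<bar>uy\<bar> = 1"
        using d
      proof
        assume "d = 1"
        then show ?thesis using adj[of k] by (simp add: ux_def uy_def)
      next
        assume "d = -1"
        then show ?thesis using adj[of "- k - 1"] by (simp add: ux_def uy_def abs_minus_commute)
      qed
      moreover have "X k - X (k + 1) = m11 * ux + m12 * uy" "Y k - Y (k + 1) = m21 * ux + m22 * uy"
        unfolding XY ux_def uy_def by (simp_all add: algebra_simps)
      moreover have "ux = 0 \<and> \<bar>uy\<bar> = 1 \<or> uy = 0 \<and> \<bar>ux\<bar> = 1" using calculation(1) by linarith
      moreover have "\<bar>m11 * ux\<bar> + \<bar>m21 * ux\<bar> = (\<bar>m11\<bar> + \<bar>m21\<bar>) * \<bar>ux\<bar>"
        "\<bar>m12 * uy\<bar> + \<bar>m22 * uy\<bar> = (\<bar>m12\<bar> + \<bar>m22\<bar>) * \<bar>uy\<bar>"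
        by (simp_all add: abs_mult algebra_simps)
      ultimately show ?thesis unfolding M(5,6) by (elim disjE conjE) simp_all
    qed
    show "m' = m" if "i \<le> m" "m \<le> j" "i \<le> m'" "m' \<le> j" "X (m - 1) = X (m + 1)" "Y (m - 1) = Y (m + 1)"
      "c (d * m) \<notin> V" "X m' = X m" "Y m' = Y m" for m m'
    proof -
      have "c (d * (m - 1)) = c (d * (m + 1))" using same that by blast
      moreover have "d * (m - 1) = d * m - 1 \<and> d * (m + 1) = d * m + 1 \<or>
          d * (m - 1) = d * m + 1 \<and> d * (m + 1) = d * m - 1" using d by auto
      ultimately have "c (d * m - 1) = c (d * m + 1)" by metis
      moreover have "c (d * m') = c (d * m)" using same that by blast
      ultimately have "L dvd d * m' - d * m" using contour_turning_point[OF cont, of "d * m" "d * m'"] that by blast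
      moreover have "d * m' - d * m = m' - m \<or> d * m' - d * m = - (m' - m)" using d by auto
      ultimately have "L dvd m' - m" by (elim disjE) (simp_all only: dvd_minus_iff)
      moreover have "\<bar>m' - m\<bar> < L" using that len by linarith
      ultimately show ?thesis by (metis dvd_imp_le_int abs_of_pos eq_iff_diff_eq_0 len linorder_not_less abs_ge_self order.strict_trans1)
    qed
    show "0 \<le> (X m - X k) * (X m' - X k) + (Y m - Y k) * (Y m' - Y k)"
      if "c (d * k) \<in> V" "(X m - X k) * (Y m' - Y k) - (Y m - Y k) * (X m' - X k) = 0" for k m m'
    proof -
      have "(x (d * m) - x (d * k)) * (y (d * m') - y (d * k)) -
          (y (d * m) - y (d * k)) * (x (d * m') - x (d * k)) = 0"
        using that(2) d unfolding det by auto
      then show ?thesis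
        unfolding dot unfolding x_def y_def
        by (intro vertex_not_between[OF finG vert that(1) inG inG])
    qed
    show "(X k' - X k) * (Y m - Y k) - (Y k' - Y k) * (X m - X k) \<le> 0"
      if k: "i \<le> k" "k < k'" "k' \<le> j" "c (d * k) \<in> V" "c (d * k') \<in> V"
        "\<forall>m. k < m \<and> m < k' \<longrightarrow> c (d * m) \<notin> V" "X k \<noteq> X k' \<or> Y k \<noteq> Y k'" for k k' m
    proof -
      have ne: "c (d * k) \<noteq> c (d * k')" using k(7) by (auto simp: X Y)
      show ?thesis
        using d
      proof
        assume d1: "d = 1"
        have "(x k' - x k) * (y m - y k) - (y k' - y k) * (x m - x k) \<le> 0"
          by (rule right) (use k ne d1 len in auto)
        then show ?thesis unfolding det using d1 by simp
      next
        assume d1: "d = -1"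
        \<comment> \<open>Reversed in time the edge runs from \<open>- k'\<close> to
          \<open>- k\<close>; this change of orientation cancels the negative determinant.\<close>
        have "(x (- k) - x (- k')) * (y (- m) - y (- k')) - (y (- k) - y (- k')) * (x (- m) - x (- k')) \<le> 0"
        proof (rule right)
          show "c n \<notin> V" if "- k' < n" "n < - k" for n
            using k(6)[rule_format, of "- n"] that d1 by auto
        qed (use k ne d1 len in auto)
        then show ?thesis unfolding det using d1 by (simp add: algebra_simps)
      qed
    qed
  qed
qed

text \<open>The signs are corrected by a diagonal or by an antidiagonal matrix. These have opposite
  determinants, so \<open>d\<close> decides between them and thereby the order of \<open>A\<close>
  and \<open>B\<close>.\<close>

lemma quadrant_normalization:
  fixes a b d :: int
  assumes ab: "a \<noteq> 0" "b \<noteq> 0" and d: "d = 1 \<or> d = -1"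
  obtains m11 m12 m21 m22 A B :: int where
    "m11 * m11 + m21 * m21 = 1" "m12 * m12 + m22 * m22 = 1" "m11 * m12 + m21 * m22 = 0"
    "m11 * m22 - m12 * m21 = d" "\<bar>m11\<bar> + \<bar>m21\<bar> = 1" "\<bar>m12\<bar> + \<bar>m22\<bar> = 1"
    "A = \<bar>a\<bar> \<and> B = \<bar>b\<bar> \<or> A = \<bar>b\<bar> \<and> B = \<bar>a\<bar>"
    "\<And>x y. A * (m11 * x + m12 * y) - B * (m21 * x + m22 * y) = a * x - b * y"
proof -
  define s t where "s = sgn a" and "t = sgn b"
  have s: "s * s = 1" "\<bar>s\<bar> = 1" "\<bar>a\<bar> * s = a" and t: "t * t = 1" "\<bar>t\<bar> = 1" "\<bar>b\<bar> * t = b"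
    using ab by (auto simp: s_def t_def sgn_if)
  have st: "s * t = 1 \<or> s * t = -1" using ab by (auto simp: s_def t_def sgn_if)
  show thesis
  proof (cases "d = s * t")
    case True
    show thesis
    proof (rule that[where ?m11.0 = s and ?m12.0 = 0 and ?m21.0 = 0 and ?m22.0 = t and A = "\<bar>a\<bar>" and B = "\<bar>b\<bar>"])
      show "\<bar>a\<bar> * (s * x + 0 * y) - \<bar>b\<bar> * (0 * x + t * y) = a * x - b * y" for x y
      proof -
        have "\<bar>a\<bar> * (s * x + 0 * y) - \<bar>b\<bar> * (0 * x + t * y) = (\<bar>a\<bar> * s) * x - (\<bar>b\<bar> * t) * y" by simp
        then show ?thesis using s t by simp
      qed
    qed (use True s t in auto)
  next
    case False
    show thesis
    proof (rule that[where ?m11.0 = 0 and ?m12.0 = "- t" and ?m21.0 = "- s" and ?m22.0 = 0 and A = "\<bar>b\<bar>" and B = "\<bar>a\<bar>"])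
      show "\<bar>b\<bar> * (0 * x + - t * y) - \<bar>a\<bar> * (- s * x + 0 * y) = a * x - b * y" for x y
      proof -
        have "\<bar>b\<bar> * (0 * x + - t * y) - \<bar>a\<bar> * (- s * x + 0 * y) = (\<bar>a\<bar> * s) * x - (\<bar>b\<bar> * t) * y" by simp
        then show ?thesis using s t by simp
      qed
    qed (use False d st s t in \<open>auto simp: mult.commute\<close>)
  qed
qed

text \<open>\<open>d = 1\<close> is for the part before the supporting edge, \<open>d = -1\<close>
  for the part after it, read backwards.\<close>

lemma card_vertices_before_upper:
  fixes d :: int
  assumes cdp: "is_cdp G" and vert: "is_vertex_set G V" and cont: "is_contour G V c L"
    and d: "d = 1 \<or> d = -1" and ab: "a \<noteq> 0" "b \<noteq> 0" "\<bar>a\<bar> \<noteq> \<bar>b\<bar>" and len: "j - i < L"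
    and line: "\<And>k. i \<le> k \<Longrightarrow> k \<le> j \<Longrightarrow> in_std_line a b \<mu> (c (d * k))"
    and pq: "i \<le> p" "p < q" "q \<le> j" "c (d * p) \<in> V" "c (d * q) \<in> V"
      "\<And>k. p < k \<Longrightarrow> k < q \<Longrightarrow> c (d * k) \<notin> V"
    and upper: "upper_leaning a b \<mu> (c (d * p))" "upper_leaning a b \<mu> (c (d * q))"
      "\<And>k. i \<le> k \<Longrightarrow> k < p \<Longrightarrow> \<not> upper_leaning a b \<mu> (c (d * k))"
  shows "card {k. i \<le> k \<and> k < p \<and> c (d * k) \<in> V} \<le> slope_complexity a b"
proof (rule quadrant_normalization[OF ab(1,2) d])
  fix m11 m12 m21 m22 A B :: int
  assume M: "m11 * m11 + m21 * m21 = 1" "m12 * m12 + m22 * m22 = 1" "m11 * m12 + m21 * m22 = 0"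
    "m11 * m22 - m12 * m21 = d" "\<bar>m11\<bar> + \<bar>m21\<bar> = 1" "\<bar>m12\<bar> + \<bar>m22\<bar> = 1"
    and AB: "A = \<bar>a\<bar> \<and> B = \<bar>b\<bar> \<or> A = \<bar>b\<bar> \<and> B = \<bar>a\<bar>"
    and res: "\<And>x y. A * (m11 * x + m12 * y) - B * (m21 * x + m22 * y) = a * x - b * y"
  define X Y where "X k = m11 * fst (c (d * k)) + m12 * snd (c (d * k))"
    and "Y k = m21 * fst (c (d * k)) + m22 * snd (c (d * k))" for k
  have rem: "A * X k - B * Y k = a * fst (c (d * k)) - b * snd (c (d * k))" for k
    by (simp only: X_def Y_def res)
  have sum: "A + B = \<bar>a\<bar> + \<bar>b\<bar>" using AB by auto
  have "strip_walk X Y (\<lambda>k. c (d * k) \<in> V) i j p q A B \<mu>"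
  proof (rule contour_strip_walk[OF cdp vert cont M d X_def Y_def len])
    show "0 < A" "0 < B" using AB ab by auto
    show "\<mu> \<le> A * X k - B * Y k \<and> A * X k - B * Y k < \<mu> + A + B" if "i \<le> k" "k \<le> j" for k
      using line[OF that] sum unfolding rem in_std_line_def by linarith
    show "A * X p - B * Y p = \<mu>" "A * X q - B * Y q = \<mu>"
      "\<And>k. i \<le> k \<Longrightarrow> k < p \<Longrightarrow> A * X k - B * Y k \<noteq> \<mu>"
      using upper unfolding rem upper_leaning_def by auto
  qed (fact pq)+
  moreover have "A \<noteq> B" using AB ab by auto
  ultimately have "card {k. i \<le> k \<and> k < p \<and> c (d * k) \<in> V} \<le> cf_depth (nat (min A B)) (nat (max A B))"
    by (rule strip_walk.card_vertices_le_cf_depth)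
  also have "\<dots> = slope_complexity a b"
    using AB by (auto simp: slope_complexity_def min.commute max.commute)
  finally show ?thesis .
qed

section \<open>Both sides of a supporting edge\<close>

lemma slope_complexity_pos:
  assumes "2 \<le> slope_complexity a b"
  shows "a \<noteq> 0" "b \<noteq> 0" "\<bar>a\<bar> \<noteq> \<bar>b\<bar>"
proof -
  have z: "cf_depth 0 k = 0" for k by (subst cf_depth.simps) simp
  have s: "cf_depth k k \<le> 1" for k by (subst cf_depth.simps) (simp add: z)
  show "a \<noteq> 0" "b \<noteq> 0" using assms z by (auto simp: slope_complexity_def)
  show "\<bar>a\<bar> \<noteq> \<bar>b\<bar>" using assms s[of "nat \<bar>b\<bar>"] by (auto simp: slope_complexity_def)
qed

lemma digital_edge_unique:
  shows "digital_edge V c L p q \<Longrightarrow> digital_edge V c L p q' \<Longrightarrow> q = q'"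
    and "digital_edge V c L p q \<Longrightarrow> digital_edge V c L p' q \<Longrightarrow> p = p'"
proof -
  show "digital_edge V c L p q \<Longrightarrow> digital_edge V c L p q' \<Longrightarrow> q = q'"
    by (cases q q' rule: linorder_cases) (auto simp: digital_edge_def)
  show "digital_edge V c L p q \<Longrightarrow> digital_edge V c L p' q \<Longrightarrow> p = p'"
    by (cases p p' rule: linorder_cases) (auto simp: digital_edge_def)
qed

theorem theorem2:
  fixes G V :: "pt set" and c :: "int \<Rightarrow> pt" and L p q i j a b \<mu> :: int and n :: nat
  assumes cdp: "is_cdp G"
    and vert: "is_vertex_set G V"
    and cont: "is_contour G V c L"
    and edge: "digital_edge V c L p q"
    and maxseg: "maximal_segment c L i j"
    and char: "char_line c i j a b \<mu>"
    and left: "leftmost_upper c i j a b \<mu> p"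
    and right: "rightmost_upper c i j a b \<mu> q"
    and cplx: "n = slope_complexity a b"
    and n2: "n \<ge> 2"
  shows "card {(p', q'). digital_edge V c L p' q' \<and> i \<le> p' \<and> q' \<le> p} \<le> n \<and>
         card {(p', q'). digital_edge V c L p' q' \<and> q \<le> p' \<and> q' \<le> j} \<le> n"
proof -
  have ab: "a \<noteq> 0" "b \<noteq> 0" "\<bar>a\<bar> \<noteq> \<bar>b\<bar>"
    using slope_complexity_pos[of a b] n2 cplx by auto
  have len: "j - i < L" using maxseg by (simp add: maximal_segment_def is_dss_def)
  have line: "in_std_line a b \<mu> (c k)" if "i \<le> k" "k \<le> j" for k
    using char that by (auto simp: char_line_def seg_in_line_def)
  have pq: "i \<le> p" "p < q" "q \<le> j" "c p \<in> V" "c q \<in> V" "\<And>k. p < k \<Longrightarrow> k < q \<Longrightarrow> c k \<notin> V"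
    using edge left right by (auto simp: digital_edge_def leftmost_upper_def rightmost_upper_def)
  have up: "upper_leaning a b \<mu> (c p)" "upper_leaning a b \<mu> (c q)"
    "\<And>k. i \<le> k \<Longrightarrow> k < p \<Longrightarrow> \<not> upper_leaning a b \<mu> (c k)"
    "\<And>k. q < k \<Longrightarrow> k \<le> j \<Longrightarrow> \<not> upper_leaning a b \<mu> (c k)"
    using left right by (auto simp: leftmost_upper_def rightmost_upper_def)
  have "card {k. i \<le> k \<and> k < p \<and> c (1 * k) \<in> V} \<le> n"
    unfolding cplx by (rule card_vertices_before_upper[where q = q, OF cdp vert cont _ ab len]) (use line pq up in auto)
  \<comment> \<open>Reversed in time, the last upper leaning point, at \<open>q\<close>, becomes the
    first, at \<open>- q\<close>.\<close>
  moreover have "card {k. - j \<le> k \<and> k < - q \<and> c (- 1 * k) \<in> V} \<le> n"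
    unfolding cplx
  proof (rule card_vertices_before_upper[where q = "- p", OF cdp vert cont _ ab])
    show "in_std_line a b \<mu> (c (- 1 * k))" if "- j \<le> k" "k \<le> - i" for k using line[of "- k"] that by simp
    show "c (- 1 * k) \<notin> V" if "- q < k" "k < - p" for k using pq(6)[of "- k"] that by simp
    show "\<not> upper_leaning a b \<mu> (c (- 1 * k))" if "- j \<le> k" "k < - q" for k using up(4)[of "- k"] that by simp
  qed (use pq up len in auto)
  ultimately have cards: "card {k. i \<le> k \<and> k < p \<and> c k \<in> V} \<le> n" "card {k. - j \<le> k \<and> k < - q \<and> c (- k) \<in> V} \<le> n"
    by simp_all
  \<comment> \<open>An edge is determined by its start, and likewise by its end, so visits to
    vertices bound the number of edges.\<close>
  have "card {(p', q'). digital_edge V c L p' q' \<and> i \<le> p' \<and> q' \<le> p} \<le> card {k. i \<le> k \<and> k < p \<and> c k \<in> V}"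
  proof (rule card_inj_on_le[where f = fst])
    show "inj_on fst {(p', q'). digital_edge V c L p' q' \<and> i \<le> p' \<and> q' \<le> p}"
      using digital_edge_unique(1) by (fastforce simp: inj_on_def)
  qed (auto simp: digital_edge_def)
  moreover have "card {(p', q'). digital_edge V c L p' q' \<and> q \<le> p' \<and> q' \<le> j} \<le>
      card {k. - j \<le> k \<and> k < - q \<and> c (- k) \<in> V}"
  proof (rule card_inj_on_le[where f = "\<lambda>e. - snd e"])
    show "inj_on (\<lambda>e. - snd e) {(p', q'). digital_edge V c L p' q' \<and> q \<le> p' \<and> q' \<le> j}"
      using digital_edge_unique(2) by (fastforce simp: inj_on_def)
  qed (auto simp: digital_edge_def)
  ultimately show ?thesis using cards by linarith
qed

end
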